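(* Let $B$ be a set of cells of an $m\times n$ array that contains exactly $h\geq 3$ cells in each row and exactly $k\geq 3$ cells in each column, and assume that $B$ admits two compatible orderings $\alpha_r$ and $\alpha_c$. Given $\Omega\subset\mathbb{Z}_{2nk+t}$ such that $[\pm x\mid x\in\Omega]$ contains each element of $\mathbb{Z}_{2nk+t}\setminus\frac{2nk+t}{t}\mathbb{Z}_{2nk+t}$ exactly once, let $\mathcal{A}$ be the set of all the $\mathrm{QH}_t(m,n;h,k)$, $A$, such that $\mathrm{skel}(A)=B$ and $\mathcal{E}(A)=\Omega$. Choose $A\in\mathcal{A}$ uniformly at random, denote by $\omega_r$ and $\omega_c$ the compatible orderings of $A$ that correspond to $\alpha_r$ and $\alpha_c$, and by $\Pi$ the Archdeacon embedding of $K_{\frac{2nk+t}{t}\times t}$ defined by $A$ (with these orderings). Then the probability that there exists $\sigma\in \mathrm{Aut}(\Pi)$ that is not a translation (i.e. that $\mathrm{Aut}(\Pi)\neq\mathbb{Z}_{2nk+t}$) is, considering $t$ fixed, $O\left(\frac{1}{nk}\right)$.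
   Context: Asymptotic convention: "$O(\cdot)$, considering $t$ fixed" means that the implied constant depends only on $t$ (not on $m,n,h,k,B,\alpha_r,\alpha_c,\Omega$). Arrays. A partially filled (p.f.) array is a matrix in which some cells may be empty. Let $v=2nk+t$ where $t$ divides $2nk$, and let $J=\frac{v}{t}\mathbb{Z}_v$ be the subgroup of $\mathbb{Z}_v$ of order $t$. A quasi-Heffter array $\mathrm{QH}_t(m,n;h,k)$ is an $m\times n$ p.f. array $A$ with entries in $\mathbb{Z}_v$ such that each row contains exactly $h$ filled cells, each column contains exactly $k$ filled cells, and the multiset $[\pm x\mid x\in A]$ contains each element of $\mathbb{Z}_v\setminus J$ exactly once. $\mathcal{E}(A)$ is the list (set) of entries of $A$; $\mathrm{skel}(A)$ is the set of filled cells of $A$. Orderings. An ordering $\alpha_r$ of the rows of $B$ is a permutation of $B$ that is the product of one cyclic permutation for each row, acting on all cells of $B$ in that row; an ordering $\alpha_c$ of the columns is defined similarly. They are compatible if $\alpha_r\circ\alpha_c$ (equivalently $\alpha_c\circ\alpha_r$) is a single cycle of length $|B|$. If $\mathrm{skel}(A)=B$ and $p(x)\in B$ is the cell of $A$ containing $x\in\mathcal{E}(A)$, the corresponding orderings of $A$ are the permutations of $\mathcal{E}(A)$ given by $\omega_r=p^{-1}\circ\alpha_r\circ p$ and $\omega_c=p^{-1}\circ\alpha_c\circ p$. Embeddings. A combinatorial embedding (into an orientable surface) of a connected graph $\Gamma$ is a pair $(\Gamma,\rho)$ where $\rho$ is a permutation of the oriented edges with $\rho(x,y)=(x,\rho_x(y))$,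 each $\rho_x$ being a cyclic permutation of all neighbours of $x$. $K_{\frac{v}{t}\times t}$ is the complete multipartite graph with $v/t$ parts of size $t$; its vertex set is identified with $\mathbb{Z}_v$, two vertices being adjacent iff their difference is not in $J$. The Archdeacon embedding defined by $A,\omega_r,\omega_c$ is $\Pi=(K_{\frac{v}{t}\times t},\rho)$ with $\rho(x,x+a)=(x,x+\rho_0(a))$, where $\rho_0$ is the permutation of $\pm\mathcal{E}(A)=\mathbb{Z}_v\setminus J$ given by $\rho_0(a)=-\omega_r(a)$ if $a\in\mathcal{E}(A)$ and $\rho_0(a)=\omega_c(-a)$ if $a\in-\mathcal{E}(A)$. Automorphisms. $\mathrm{Aut}(\Pi)$ is the group of graph automorphisms $\sigma$ (acting on oriented edges by $\sigma(x,y)=(\sigma(x),\sigma(y))$) such that either $\sigma\circ\rho=\rho\circ\sigma$ or $\sigma\circ\rho=\rho^{-1}\circ\sigma$. All translations $\tau_g(x)=x+g$, $g\in\mathbb{Z}_v$, belong to $\mathrm{Aut}(\Pi)$, and $\mathrm{Aut}(\Pi)=\mathbb{Z}_v$ means that it consists exactly of the translations. *)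

theory Defs
  imports
    "HOL-Probability.Probability"
    "HOL-Combinatorics.Orbits"
    "Graph_Theory.Pair_Digraph"
begin

text \<open>The group \<open>\<int>\<^sub>v\<close> is represented by the residues \<open>0, \<dots>, v - 1\<close>
  of type \<^typ>\<open>int\<close>, with all arithmetic carried out modulo \<open>v\<close>.\<close>

definition Zmod :: "nat \<Rightarrow> int set" where
  "Zmod v = {0..<int v}"

text \<open>The subgroup \<open>J = (v/t) \<int>\<^sub>v\<close>, which has order \<open>t\<close> if \<open>t\<close> divides \<open>v\<close>.\<close>

definition Jsub :: "nat \<Rightarrow> nat \<Rightarrow> int set" where
  "Jsub v t = (\<lambda>x. (int (v div t) * x) mod int v) ` Zmod v"

definition plus_minus :: "nat \<Rightarrow> int multiset \<Rightarrow> int multiset" where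
  "plus_minus v M = M + image_mset (\<lambda>x. (- x) mod int v) M"

section \<open>Arrays\<close>

text \<open>A cell is a pair (row, column), with rows and columns numbered from 0. A partially
  filled array is a partial function on cells; the empty cells are mapped to \<^const>\<open>None\<close>.\<close>

type_synonym cell = "nat \<times> nat"
type_synonym pf_array = "cell \<rightharpoonup> int"

definition row_of :: "cell set \<Rightarrow> nat \<Rightarrow> cell set" where
  "row_of B i = {c \<in> B. fst c = i}"

definition col_of :: "cell set \<Rightarrow> nat \<Rightarrow> cell set" where
  "col_of B j = {c \<in> B. snd c = j}"

definition cell_set :: "nat \<Rightarrow> nat \<Rightarrow> nat \<Rightarrow> nat \<Rightarrow> cell set \<Rightarrow> bool" where
  "cell_set m n h k B \<longleftrightarrow>
     B \<subseteq> {..<m} \<times> {..<n} \<and>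
     (\<forall>i<m. card (row_of B i) = h) \<and>
     (\<forall>j<n. card (col_of B j) = k)"

abbreviation skel :: "pf_array \<Rightarrow> cell set" where
  "skel A \<equiv> dom A"

abbreviation entries :: "pf_array \<Rightarrow> int set" where
  "entries A \<equiv> ran A"

text \<open>The entries with their multiplicities in the array.\<close>

definition entries_mset :: "pf_array \<Rightarrow> int multiset" where
  "entries_mset A = image_mset (\<lambda>c. the (A c)) (mset_set (skel A))"

definition quasi_Heffter :: "nat \<Rightarrow> nat \<Rightarrow> nat \<Rightarrow> nat \<Rightarrow> nat \<Rightarrow> pf_array \<Rightarrow> bool" where
  "quasi_Heffter t m n h k A \<longleftrightarrow>
     (let v = 2 * n * k + t in
        t > 0 \<and> t dvd 2 * n * k \<and>
        cell_set m n h k (skel A) \<and>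
        entries A \<subseteq> Zmod v \<and>
        plus_minus v (entries_mset A) = mset_set (Zmod v - Jsub v t))"

definition QH_class ::
    "nat \<Rightarrow> nat \<Rightarrow> nat \<Rightarrow> nat \<Rightarrow> nat \<Rightarrow> cell set \<Rightarrow> int set \<Rightarrow> pf_array set" where
  "QH_class t m n h k B \<Omega> = {A. quasi_Heffter t m n h k A \<and> skel A = B \<and> entries A = \<Omega>}"

section \<open>Orderings\<close>

definition row_ordering :: "cell set \<Rightarrow> (cell \<Rightarrow> cell) \<Rightarrow> bool" where
  "row_ordering B \<alpha> \<longleftrightarrow> \<alpha> permutes B \<and> (\<forall>i \<in> fst ` B. cyclic_on \<alpha> (row_of B i))"

definition col_ordering :: "cell set \<Rightarrow> (cell \<Rightarrow> cell) \<Rightarrow> bool" where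
  "col_ordering B \<alpha> \<longleftrightarrow> \<alpha> permutes B \<and> (\<forall>j \<in> snd ` B. cyclic_on \<alpha> (col_of B j))"

definition compatible_orderings ::
    "cell set \<Rightarrow> (cell \<Rightarrow> cell) \<Rightarrow> (cell \<Rightarrow> cell) \<Rightarrow> bool" where
  "compatible_orderings B \<alpha>r \<alpha>c \<longleftrightarrow>
     row_ordering B \<alpha>r \<and> col_ordering B \<alpha>c \<and> cyclic_on (\<alpha>r \<circ> \<alpha>c) B"

text \<open>The cell containing a given entry; meaningful when the entries are pairwise distinct,
  as they are in a quasi-Heffter array.\<close>

definition position :: "pf_array \<Rightarrow> int \<Rightarrow> cell" where
  "position A x = (THE c. A c = Some x)"

definition entry_ordering :: "pf_array \<Rightarrow> (cell \<Rightarrow> cell) \<Rightarrow> int \<Rightarrow> int" where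
  "entry_ordering A \<alpha> x = the (A (\<alpha> (position A x)))"

section \<open>Embeddings\<close>

text \<open>An embedding is a graph together with a permutation of its oriented edges. Graphs are
  symmetric loop-free digraphs, whose arcs are the oriented edges. The permutation is
  the identity on pairs that are not oriented edges.\<close>

type_synonym 'a embedding = "'a pair_pre_digraph \<times> ('a \<times> 'a \<Rightarrow> 'a \<times> 'a)"

text \<open>The complete multipartite graph on \<open>\<int>\<^sub>v\<close> whose parts are the cosets of \<open>J\<close>.\<close>

definition multipartite_graph :: "nat \<Rightarrow> nat \<Rightarrow> int pair_pre_digraph" where
  "multipartite_graph v t =
     \<lparr> pverts = Zmod v,
       parcs = {(x, y). x \<in> Zmod v \<and> y \<in> Zmod v \<and> (y - x) mod int v \<notin> Jsub v t} \<rparr>"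

definition rho0 :: "nat \<Rightarrow> pf_array \<Rightarrow> (int \<Rightarrow> int) \<Rightarrow> (int \<Rightarrow> int) \<Rightarrow> int \<Rightarrow> int" where
  "rho0 v A \<omega>r \<omega>c a =
     (if a \<in> entries A then (- \<omega>r a) mod int v else \<omega>c ((- a) mod int v))"

definition Archdeacon_embedding ::
    "nat \<Rightarrow> nat \<Rightarrow> pf_array \<Rightarrow> (int \<Rightarrow> int) \<Rightarrow> (int \<Rightarrow> int) \<Rightarrow> int embedding" where
  "Archdeacon_embedding v t A \<omega>r \<omega>c =
     (multipartite_graph v t,
      \<lambda>(x, y). if (x, y) \<in> parcs (multipartite_graph v t)
               then (x, (x + rho0 v A \<omega>r \<omega>c ((y - x) mod int v)) mod int v)
               else (x, y))"

section \<open>Automorphisms\<close>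

definition graph_automorphism :: "'a pair_pre_digraph \<Rightarrow> ('a \<Rightarrow> 'a) \<Rightarrow> bool" where
  "graph_automorphism G \<sigma> \<longleftrightarrow>
     \<sigma> permutes pverts G \<and>
     (\<forall>x \<in> pverts G. \<forall>y \<in> pverts G. (\<sigma> x, \<sigma> y) \<in> parcs G \<longleftrightarrow> (x, y) \<in> parcs G)"

definition embedding_Aut :: "'a embedding \<Rightarrow> ('a \<Rightarrow> 'a) set" where
  "embedding_Aut P =
     (case P of (G, \<rho>) \<Rightarrow>
       {\<sigma>. graph_automorphism G \<sigma> \<and>
          ((\<forall>e \<in> parcs G. map_prod \<sigma> \<sigma> (\<rho> e) = \<rho> (map_prod \<sigma> \<sigma> e)) \<or>
           (\<forall>e \<in> parcs G. map_prod \<sigma> \<sigma> (\<rho> e) = inv \<rho> (map_prod \<sigma> \<sigma> e)))})"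

text \<open>Like the automorphisms, translations are extended by the identity outside \<open>\<int>\<^sub>v\<close>.\<close>

definition translation :: "nat \<Rightarrow> int \<Rightarrow> int \<Rightarrow> int" where
  "translation v g x = (if x \<in> Zmod v then (x + g) mod int v else x)"

end

theory Submission
  imports Defs "HOL-Number_Theory.Cong"
begin

text \<open>
  Put \<open>N = nk\<close>. The local rotation is one fixed cyclic permutation \<open>rot\<close> of the \<open>2N\<close> signed
  cells (darts), independent of \<open>A\<close>; only the values \<open>val p\<close> of the darts are random. An
  automorphism \<open>\<sigma>\<close> maps the darts at each vertex \<open>x\<close> by a dihedral symmetry \<open>M x\<close> of \<open>rot\<close>, and
  the type \<open>\<epsilon>\<close> together with \<open>S = M 0\<close> determines \<open>M (val p)\<close> for all darts \<open>p\<close> through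
  \<open>M (val p) (-p) = - S p\<close>. So there are at most \<open>4N\<close> candidates for \<open>S\<close>, and it suffices
  that each arises with probability \<open>O(1/N\<^sup>2)\<close>.

  Computing \<open>\<sigma> (val p + val q)\<close> along two paths gives
  \<open>val (S p) + val (M (val p) q) = val (S q) + val (M (val q) p)\<close> for all \<open>p\<close> and \<open>q\<close>. If some
  \<open>M (val p)\<close> differs from \<open>S\<close>, two choices of \<open>q\<close> yield two independent linear equations for
  the entries. Otherwise \<open>\<sigma> - \<sigma> 0\<close> is multiplication by some \<open>u\<close>, so \<open>val (S p) = u val p\<close>; three
  disjoint pairs of cells and the union bound over the \<open>O(N)\<close> values of \<open>u\<close> suffice. Row and
  column sizes of at least 3 ensure that \<open>S\<close> moves the cells of at least half of the darts.
\<close>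

section \<open>Counting bijections with prescribed pivots\<close>

text \<open>When \<open>B\<close> is finite and \<open>card B = card \<Omega>\<close>, surjectivity
  onto \<open>\<Omega>\<close> forces injectivity, so in that case these are the bijections from
  \<open>B\<close> to \<open>\<Omega>\<close>.\<close>

definition bij_maps :: "'a set \<Rightarrow> 'b set \<Rightarrow> ('a \<rightharpoonup> 'b) set" where
  "bij_maps B \<Omega> = {A. dom A = B \<and> ran A = \<Omega>}"

lemma finite_bij_maps: "finite B \<Longrightarrow> finite \<Omega> \<Longrightarrow> finite (bij_maps B \<Omega>)"
  unfolding bij_maps_def
  by (rule finite_subset[OF _ finite_set_of_finite_maps[of B \<Omega>]]) auto

lemma bij_maps_inj_on:
  assumes "finite B" "card B = card \<Omega>" "A \<in> bij_maps B \<Omega>"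
  shows "inj_on (\<lambda>c. the (A c)) B" "(\<lambda>c. the (A c)) ` B = \<Omega>"
proof -
  show im: "(\<lambda>c. the (A c)) ` B = \<Omega>"
    using assms(3) by (force simp: bij_maps_def ran_def image_iff dom_def)
  show "inj_on (\<lambda>c. the (A c)) B"
    using im assms by (intro eq_card_imp_inj_on) auto
qed

text \<open>Split by the label \<open>x\<close> of the new cell \<open>c\<close>: deleting
  \<open>c\<close> leaves a labelling of \<open>B\<close> by \<open>\<Omega> - {x}\<close>.\<close>

lemma card_bij_maps:
  assumes "finite B" "finite \<Omega>" "card B = card \<Omega>"
  shows "card (bij_maps B \<Omega>) = fact (card B)"
  using assms
proof (induction B arbitrary: \<Omega> rule: finite_induct)
  case empty
  then have "bij_maps {} \<Omega> = {Map.empty :: 'a \<rightharpoonup> 'b}" by (auto simp: bij_maps_def)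
  then show ?case by simp
next
  case (insert c B)
  define F where "F = (\<lambda>x. (\<lambda>A. A(c \<mapsto> x)) ` bij_maps B (\<Omega> - {x}))"
  have eq: "bij_maps (insert c B) \<Omega> = (\<Union>x\<in>\<Omega>. F x)"
  proof (intro set_eqI iffI)
    fix A assume A: "A \<in> bij_maps (insert c B) \<Omega>"
    have fin: "finite (insert c B)" using insert by simp
    note inj = bij_maps_inj_on[OF fin insert.prems(2) A]
    obtain x where x: "A c = Some x" using A by (auto simp: bij_maps_def)
    have "x \<in> \<Omega>" using A x by (auto simp: bij_maps_def ran_def)
    have dom: "dom (A(c := None)) = B" using A insert.hyps by (auto simp: bij_maps_def)
    have "ran (A(c := None)) = \<Omega> - {x}"
    proof (intro set_eqI iffI)
      fix y assume "y \<in> ran (A(c := None))"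
      then obtain d where d: "d \<noteq> c" "A d = Some y" by (auto simp: ran_def split: if_splits)
      have "d \<in> insert c B" "y \<in> \<Omega>" using d A by (auto simp: bij_maps_def ran_def)
      moreover have "y \<noteq> x" using inj_onD[OF inj(1), of d c] d x \<open>d \<in> _\<close> by auto
      ultimately show "y \<in> \<Omega> - {x}" by auto
    next
      fix y assume "y \<in> \<Omega> - {x}"
      then obtain d where "A d = Some y" using A by (auto simp: bij_maps_def ran_def)
      then have "(A(c := None)) d = Some y" using \<open>y \<in> \<Omega> - {x}\<close> x by auto
      then show "y \<in> ran (A(c := None))" by (rule ranI)
    qed
    then have "A(c := None) \<in> bij_maps B (\<Omega> - {x})" using dom by (simp add: bij_maps_def)
    moreover have "A = (A(c := None))(c \<mapsto> x)" using x by auto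
    ultimately have "A \<in> F x" unfolding F_def by blast
    then show "A \<in> (\<Union>x\<in>\<Omega>. F x)" using \<open>x \<in> \<Omega>\<close> by blast
  next
    fix A assume "A \<in> (\<Union>x\<in>\<Omega>. F x)"
    then obtain x A' where "x \<in> \<Omega>" "A' \<in> bij_maps B (\<Omega> - {x})" "A = A'(c \<mapsto> x)"
      unfolding F_def by auto
    moreover have "A' c = None" using calculation insert.hyps by (auto simp: bij_maps_def)
    ultimately show "A \<in> bij_maps (insert c B) \<Omega>" by (auto simp: bij_maps_def)
  qed
  have card: "card (F x) = fact (card B)" if "x \<in> \<Omega>" for x
  proof -
    have "inj_on (\<lambda>A. A(c \<mapsto> x)) (bij_maps B (\<Omega> - {x}))"
    proof (rule inj_onI)
      fix A A' assume AA: "A \<in> bij_maps B (\<Omega> - {x})" "A' \<in> bij_maps B (\<Omega> - {x})"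
        "A(c \<mapsto> x) = A'(c \<mapsto> x)"
      then have "A c = A' c" using insert.hyps by (auto simp: bij_maps_def domIff)
      then show "A = A'" using AA(3) by (metis fun_upd_triv fun_upd_upd)
    qed
    then have "card (F x) = card (bij_maps B (\<Omega> - {x}))" unfolding F_def by (rule card_image)
    also have "\<dots> = fact (card B)" using insert that by (intro insert.IH) auto
    finally show ?thesis .
  qed
  have disj: "F x \<inter> F y = {}" if "x \<noteq> y" for x y
    using that unfolding F_def by (auto dest: fun_cong[of _ _ c])
  have "card (\<Union>x\<in>\<Omega>. F x) = (\<Sum>x\<in>\<Omega>. card (F x))"
    using insert disj by (intro card_UN_disjoint) (auto simp: F_def finite_bij_maps)
  also have "\<dots> = card \<Omega> * fact (card B)" using card by simp
  finally show ?case using eq insert by (metis card_insert_disjoint fact_Suc of_nat_id)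
qed

lemma card_le_restrictions:
  assumes "finite B" "finite \<Omega>" "card B = card \<Omega>" "X \<subseteq> bij_maps B \<Omega>" "D \<subseteq> B"
  shows "card X \<le> card ((\<lambda>A. A |` D) ` X) * fact (card B - card D)"
proof -
  have finX: "finite X" using assms finite_bij_maps finite_subset by metis
  have fib: "card {A \<in> X. A |` D = g} \<le> fact (card B - card D)" if g: "g \<in> (\<lambda>A. A |` D) ` X" for g
  proof -
    obtain A0 where A0: "A0 \<in> X" "g = A0 |` D" using g by auto
    note inj = bij_maps_inj_on[OF assms(1,3), of A0]
    have ran: "ran (A |` D') = (\<lambda>c. the (A c)) ` D'" if "A \<in> X" "D' \<subseteq> B" for A D'
      using that assms(4) by (force simp: bij_maps_def ran_def restrict_map_def image_iff dom_def)
    have "card (ran g) = card D"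
      using inj A0 assms(4,5) ran[of A0 D] by (metis card_image inj_on_subset subsetD)
    moreover have "ran g \<subseteq> \<Omega>" using A0 assms(4) by (auto simp: bij_maps_def ran_def restrict_map_def)
    ultimately have c: "card (\<Omega> - ran g) = card B - card D"
      using assms by (metis card_Diff_subset finite_subset)
    have "(\<lambda>A. A |` (B - D)) ` {A \<in> X. A |` D = g} \<subseteq> bij_maps (B - D) (\<Omega> - ran g)"
    proof clarsimp
      fix A assume A: "A \<in> X" "g = A |` D"
      note i = bij_maps_inj_on[OF assms(1,3), of A]
      have AB: "A \<in> bij_maps B \<Omega>" using A assms by auto
      have "ran (A |` (B - D)) = \<Omega> - ran (A |` D)"
        using i(2)[OF AB] ran[OF A(1), of "B - D"] ran[OF A(1) assms(5)]
          inj_on_image_set_diff[OF i(1)[OF AB], of B D] assms(5) by auto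
      moreover have "dom (A |` (B - D)) = B - D" using AB by (auto simp: bij_maps_def)
      ultimately show "A |` (B - D) \<in> bij_maps (B - D) (\<Omega> - ran (A |` D))"
        by (simp add: bij_maps_def)
    qed
    moreover have "inj_on (\<lambda>A. A |` (B - D)) {A \<in> X. A |` D = g}"
    proof (rule inj_onI)
      fix A A' assume a: "A \<in> {A \<in> X. A |` D = g}" "A' \<in> {A \<in> X. A |` D = g}"
        "A |` (B - D) = A' |` (B - D)"
      show "A = A'"
      proof
        fix c
        consider "c \<in> D" | "c \<in> B - D" | "c \<notin> B" by blast
        then show "A c = A' c"
        proof cases
          case 1 then show ?thesis using a by (metis (mono_tags, lifting) mem_Collect_eq restrict_in)
        next
          case 2 then show ?thesis using a by (metis restrict_in)
        next
          case 3
          then have "c \<notin> dom A" "c \<notin> dom A'" using a assms(4) by (auto simp: bij_maps_def)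
          then show ?thesis by (simp add: domIff)
        qed
      qed
    qed
    ultimately have "card {A \<in> X. A |` D = g} \<le> card (bij_maps (B - D) (\<Omega> - ran g))"
      using assms by (intro card_inj_on_le[of _ _ "bij_maps (B - D) (\<Omega> - ran g)"] finite_bij_maps) auto
    also have "\<dots> = fact (card B - card D)"
      using card_bij_maps[of "B - D" "\<Omega> - ran g"] c assms
      by (simp add: card_Diff_subset finite_subset[OF assms(5)])
    finally show ?thesis .
  qed
  have "X = (\<Union>g\<in>(\<lambda>A. A |` D) ` X. {A \<in> X. A |` D = g})" by auto
  then have "card X \<le> (\<Sum>g\<in>(\<lambda>A. A |` D) ` X. card {A \<in> X. A |` D = g})"
    using card_UN_le[of "(\<lambda>A. A |` D) ` X" "\<lambda>g. {A \<in> X. A |` D = g}"] finX by simp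
  also have "\<dots> \<le> (\<Sum>g\<in>(\<lambda>A. A |` D) ` X. fact (card B - card D))"
    using fib by (intro sum_mono)
  finally show ?thesis by simp
qed

lemma card_restrictions_free:
  assumes "X \<subseteq> bij_maps B \<Omega>" "D \<subseteq> B" "finite B" "finite \<Omega>"
  shows "card ((\<lambda>A. A |` D) ` X) \<le> card \<Omega> ^ card D"
proof -
  have fD: "finite D" using assms finite_subset by blast
  have "inj_on (\<lambda>g. restrict (\<lambda>c. the (g c)) D) ((\<lambda>A. A |` D) ` X)"
  proof (rule inj_onI, clarsimp)
    fix A A' assume a: "A \<in> X" "A' \<in> X"
      "restrict (\<lambda>c. the ((A |` D) c)) D = restrict (\<lambda>c. the ((A' |` D) c)) D"
    show "A |` D = A' |` D"
    proof
      fix c show "(A |` D) c = (A' |` D) c"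
      proof (cases "c \<in> D")
        case True
        then have "the (A c) = the (A' c)" using fun_cong[OF a(3), of c] by simp
        moreover have "c \<in> dom A" "c \<in> dom A'" using a True assms by (auto simp: bij_maps_def)
        ultimately show ?thesis using True by auto
      qed simp
    qed
  qed
  moreover have "(\<lambda>g. restrict (\<lambda>c. the (g c)) D) ` (\<lambda>A. A |` D) ` X \<subseteq> D \<rightarrow>\<^sub>E \<Omega>"
    using assms by (force simp: bij_maps_def ran_def dom_def subset_iff)
  ultimately have "card ((\<lambda>A. A |` D) ` X) \<le> card (D \<rightarrow>\<^sub>E \<Omega>)"
    using fD assms by (intro card_inj_on_le[of "\<lambda>g. restrict (\<lambda>c. the (g c)) D"] finite_PiE) auto
  then show ?thesis using fD by (simp add: card_PiE)
qed

text \<open>A restriction to \<open>insert c D\<close> amounts to a restriction to \<open>D\<close>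
  together with the label of the pivot \<open>c\<close>. An equation leaves at most \<open>K\<close>
  choices for that label once \<open>D\<close> is labelled, so a pivot costs a factor
  \<open>K\<close> where a free cell costs \<open>card \<Omega>\<close>.\<close>

lemma card_restrictions_insert:
  assumes "finite X"
    and pivot: "\<And>A. A \<in> X \<Longrightarrow> card {A' c |A'. A' \<in> X \<and> A' |` D = A |` D} \<le> K"
  shows "card ((\<lambda>A. A |` insert c D) ` X) \<le> card ((\<lambda>A. A |` D) ` X) * K"
proof -
  let ?R = "\<lambda>D. (\<lambda>A. A |` D) ` X"
  define F where "F g = {A' c |A'. A' \<in> X \<and> A' |` D = g}" for g
  have fF: "finite (F g)" for g
    by (rule finite_subset[of _ "(\<lambda>A. A c) ` X"]) (use assms in \<open>auto simp: F_def\<close>)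
  have "inj_on (\<lambda>g. (g |` D, g c)) (?R (insert c D))"
  proof (rule inj_onI, clarsimp)
    fix A A' assume "A |` (insert c D \<inter> D) = A' |` (insert c D \<inter> D)" "A c = A' c"
    then have "A |` D = A' |` D" by (metis Int_absorb1 subset_insertI)
    then show "A |` insert c D = A' |` insert c D"
      using \<open>A c = A' c\<close> by (auto simp: restrict_map_def fun_eq_iff split: if_splits)
  qed
  moreover have "(\<lambda>g. (g |` D, g c)) ` ?R (insert c D) \<subseteq> (SIGMA g:?R D. F g)"
    by (auto simp: F_def restrict_restrict image_iff Int_absorb1 subset_insertI)
  ultimately have "card (?R (insert c D)) \<le> card (SIGMA g:?R D. F g)"
    using assms(1) fF by (intro card_inj_on_le[of "\<lambda>g. (g |` D, g c)"] finite_SigmaI) auto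
  also have "\<dots> = (\<Sum>g\<in>?R D. card (F g))" using assms(1) fF by (intro card_SigmaI) auto
  also have "\<dots> \<le> (\<Sum>g\<in>?R D. K)" using pivot by (intro sum_mono) (auto simp: F_def)
  finally show ?thesis by simp
qed

text \<open>Each of the \<open>s\<close> factors \<open>N, ..., N - s + 1\<close> that separate
  \<open>fact N\<close> from \<open>fact (N - s)\<close> is at least \<open>N / 2\<close>.\<close>

lemma fact_diff_power_le:
  assumes "2 * s \<le> N"
  shows "fact (N - s) * N ^ s \<le> 2 ^ s * (fact N :: nat)"
  using assms
proof (induction s)
  case (Suc s)
  have "fact (N - s) = (N - s) * (fact (N - Suc s) :: nat)"
    using Suc.prems by (simp add: fact_reduce)
  moreover have "N \<le> 2 * (N - s)" using Suc.prems by simp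
  ultimately have "fact (N - Suc s) * N \<le> 2 * (fact (N - s) :: nat)" by simp
  then have "fact (N - Suc s) * N ^ Suc s \<le> 2 * (fact (N - s) * N ^ s)"
    by (metis (no_types, lifting) mult.assoc mult_le_mono1 power_Suc)
  also have "\<dots> \<le> 2 * (2 ^ s * fact N)" using Suc by (intro mult_le_mono2) auto
  finally show ?case by simp
qed simp

text \<open>Here \<open>r\<close> cells of \<open>D\<close> are pivots, and \<open>K\<close> bounds the number of choices for their labels.\<close>

lemma card_bij_maps_le:
  assumes "finite B" "finite \<Omega>" "card B = card \<Omega>" "X \<subseteq> bij_maps B \<Omega>" "D \<subseteq> B"
    and "r \<le> card D" "card D \<le> s" "2 * s \<le> card B" "0 < card B"
    and "card ((\<lambda>A. A |` D) ` X) \<le> card B ^ (card D - r) * K"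
  shows "real (card X) \<le> real K * 2 ^ s / real (card B) ^ r * fact (card B)"
proof -
  let ?N = "card B" and ?d = "card D"
  have "card X \<le> (?N ^ (?d - r) * K) * fact (?N - ?d)"
    using card_le_restrictions[OF assms(1-5)] assms(10) by (meson le_trans mult_le_mono1)
  then have "card X * ?N ^ r \<le> ((?N ^ (?d - r) * K) * fact (?N - ?d)) * ?N ^ r"
    by (rule mult_le_mono1)
  also have "\<dots> = K * (fact (?N - ?d) * ?N ^ ?d)"
    using assms(6) by (simp add: mult.commute mult.left_commute flip: power_add)
  also have "\<dots> \<le> K * (2 ^ ?d * fact ?N)"
    using assms by (intro mult_le_mono2 fact_diff_power_le) auto
  also have "\<dots> \<le> K * (2 ^ s * fact ?N)"
    using assms by (intro mult_le_mono) (auto intro: power_increasing)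
  finally have "real (card X * ?N ^ r) \<le> real (K * (2 ^ s * fact ?N))"
    by (simp only: of_nat_le_iff)
  then show ?thesis using assms(9) by (simp add: field_simps)
qed

section \<open>Linear equations between random labels\<close>

text \<open>On the solutions the remainder of \<open>|g| * x\<close> modulo \<open>v\<close> is
  constant, so \<open>x\<close> is determined by the quotient, which takes at most
  \<open>|g|\<close> values.\<close>

lemma card_cong_solutions:
  fixes g x0 :: int
  assumes "g \<noteq> 0"
  shows "card {x \<in> {0..<int v}. [g * x = g * x0] (mod int v)} \<le> nat \<bar>g\<bar>"
proof -
  let ?S = "{x \<in> {0..<int v}. [g * x = g * x0] (mod int v)}"
  let ?f = "\<lambda>x. (\<bar>g\<bar> * x) div int v"
  have cong: "[\<bar>g\<bar> * x = \<bar>g\<bar> * y] (mod int v)" if "x \<in> ?S" "y \<in> ?S" for x y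
  proof -
    have "[g * x = g * y] (mod int v)"
      using that by (auto intro: cong_trans cong_sym)
    then have "[sgn g * (g * x) = sgn g * (g * y)] (mod int v)" by (rule cong_scalar_left)
    moreover have "sgn g * (g * z) = \<bar>g\<bar> * z" for z
      using assms by (cases "0 < g") auto
    ultimately show ?thesis by simp
  qed
  have "inj_on ?f ?S"
  proof (rule inj_onI)
    fix x y assume xy: "x \<in> ?S" "y \<in> ?S" "?f x = ?f y"
    have "\<bar>g\<bar> * x = \<bar>g\<bar> * y"
      using cong[OF xy(1,2)] xy(3) unfolding cong_def by (metis div_mult_mod_eq)
    then show "x = y" using assms by simp
  qed
  moreover have "?f ` ?S \<subseteq> {0..<\<bar>g\<bar>}"
  proof clarsimp
    fix x assume "0 \<le> x" "x < int v"
    then have "\<bar>g\<bar> * x < \<bar>g\<bar> * int v" "0 \<le> \<bar>g\<bar> * x" using assms by auto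
    moreover have "0 < int v" using \<open>0 \<le> x\<close> \<open>x < int v\<close> by linarith
    ultimately show "0 \<le> \<bar>g\<bar> * x div int v \<and> \<bar>g\<bar> * x div int v < \<bar>g\<bar>"
      using pos_mod_sign[of "int v" "\<bar>g\<bar> * x"] div_mult_mod_eq[of "\<bar>g\<bar> * x" "int v"]
      by (smt (verit) mult_right_less_imp_less pos_imp_zdiv_nonneg_iff)
  qed
  ultimately have "card ?S \<le> card {0..<\<bar>g\<bar>}" by (intro card_inj_on_le[of ?f]) auto
  then show ?thesis by simp
qed

section \<open>Darts and linear equations between their values\<close>

text \<open>A dart \<open>(c, s)\<close> is a cell together with a sign; it carries the entry of \<open>c\<close> or,
  if \<open>s\<close> is false, its negative.\<close>

definition dart_val :: "('a \<rightharpoonup> int) \<Rightarrow> 'a \<times> bool \<Rightarrow> int" where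
  "dart_val A p = (if snd p then the (A (fst p)) else - the (A (fst p)))"

definition neg :: "'a \<times> bool \<Rightarrow> 'a \<times> bool" where
  "neg p = (fst p, \<not> snd p)"

lemma fst_neg [simp]: "fst (neg p) = fst p"
  and snd_neg [simp]: "snd (neg p) = (\<not> snd p)"
  and neg_neg [simp]: "neg (neg p) = p"
  and neg_neq [simp]: "neg p \<noteq> p"
  by (simp_all add: neg_def prod_eq_iff)

lemma dart_val_neg [simp]: "dart_val A (neg p) = - dart_val A p"
  by (simp add: dart_val_def neg_def)

lemma fst_eq_cases: "fst p = fst q \<longleftrightarrow> p = q \<or> p = neg q"
  by (auto simp: neg_def prod_eq_iff)

text \<open>The coefficient of the label of \<open>e\<close> in \<open>dart_val A p\<close>, read as
  a linear form in the labels.\<close>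

definition dart_coeff :: "'a \<Rightarrow> 'a \<times> bool \<Rightarrow> int" where
  "dart_coeff e p = (if fst p = e then if snd p then 1 else -1 else 0)"

lemma dart_val_diff:
  assumes "fst p \<in> insert e D" "A |` D = A' |` D"
  shows "dart_val A' p - dart_val A p = dart_coeff e p * (the (A' e) - the (A e))"
proof (cases "fst p = e")
  case False
  then have "A (fst p) = A' (fst p)" using assms by (metis insertE restrict_in)
  with False show ?thesis by (simp add: dart_val_def dart_coeff_def)
qed (auto simp: dart_val_def dart_coeff_def)

text \<open>If \<open>d = neg c\<close>, the last two terms cancel and the cell of \<open>b\<close>
  works, as it is neither that of \<open>a\<close> nor that of \<open>c\<close>. Otherwise take the
  cell of \<open>c\<close>: there the contributions of \<open>b\<close>, \<open>c\<close> and
  \<open>d\<close>, with their signs, cannot cancel, since only \<open>b = neg c\<close> and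
  \<open>d = c\<close> can share this cell.\<close>

lemma pivot_exists:
  assumes "fst a \<notin> {fst b, fst c}" "b \<noteq> c" "b \<noteq> d"
  obtains e where "e \<in> {fst b, fst c}"
    "dart_coeff e a + dart_coeff e b - dart_coeff e c - dart_coeff e d \<noteq> 0"
proof (cases "d = neg c")
  case True
  then have "fst b \<noteq> fst c" using assms by (auto simp: fst_eq_cases)
  then show ?thesis using assms True that[of "fst b"] by (auto simp: dart_coeff_def)
next
  case False
  then show ?thesis using assms that[of "fst c"]
    by (cases "fst b = fst c"; cases "fst d = fst c") (auto simp: dart_coeff_def prod_eq_iff)
qed

text \<open>The case \<open>x = y\<close> of the last assumption excludes labels with
  \<open>2 x = 0\<close>, so the two darts of one cell also carry different residues.\<close>

locale labelling =
  fixes B :: "'a set" and \<Omega> :: "int set" and v :: nat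
  assumes finite_B: "finite B"
    and finite_\<Omega>: "finite \<Omega>"
    and card_\<Omega>: "card B = card \<Omega>"
    and \<Omega>_range: "\<Omega> \<subseteq> {0..<int v}"
    and \<Omega>_anti: "x \<in> \<Omega> \<Longrightarrow> y \<in> \<Omega> \<Longrightarrow> \<not> [x = - y] (mod int v)"
begin

lemma label_in: "A \<in> bij_maps B \<Omega> \<Longrightarrow> c \<in> B \<Longrightarrow> the (A c) \<in> \<Omega>"
  using bij_maps_inj_on(2)[OF finite_B card_\<Omega>] by blast

lemma \<Omega>_cong: "x \<in> \<Omega> \<Longrightarrow> y \<in> \<Omega> \<Longrightarrow> [x = y] (mod int v) \<Longrightarrow> x = y"
  using \<Omega>_range by (intro cong_less_imp_eq_int) auto

lemma dart_val_inj:
  assumes "A \<in> bij_maps B \<Omega>" "fst p \<in> B" "fst q \<in> B" "[dart_val A p = dart_val A q] (mod int v)"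
  shows "p = q"
proof -
  have \<Omega>: "the (A (fst p)) \<in> \<Omega>" "the (A (fst q)) \<in> \<Omega>" using assms label_in by auto
  have "snd p = snd q"
  proof (rule ccontr)
    assume "snd p \<noteq> snd q"
    then have "[the (A (fst p)) = - the (A (fst q))] (mod int v)"
      using assms(4) by (auto simp: dart_val_def cong_minus_minus_iff split: if_splits)
        (metis add.inverse_inverse cong_minus_minus_iff)
    then show False using \<Omega>_anti \<Omega> by blast
  qed
  then have "[the (A (fst p)) = the (A (fst q))] (mod int v)"
    using assms(4) by (auto simp: dart_val_def cong_minus_minus_iff split: if_splits)
  then have "the (A (fst p)) = the (A (fst q))" using \<Omega>_cong \<Omega> by blast
  then have "fst p = fst q"
    using bij_maps_inj_on(1)[OF finite_B card_\<Omega> assms(1)] assms(2,3) by (auto dest: inj_onD)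
  with \<open>snd p = snd q\<close> show ?thesis by (simp add: prod_eq_iff)
qed

lemma bij_maps_Some: "A \<in> bij_maps B \<Omega> \<Longrightarrow> c \<in> B \<Longrightarrow> A c = Some (the (A c))"
  by (auto simp: bij_maps_def)

text \<open>With the labels on \<open>D\<close> fixed, the equation becomes a congruence for
  \<open>?g\<close> times the label of \<open>e\<close>. Each of the four darts contributes at most
  1 to \<open>|?g|\<close>, hence the bound 4.\<close>

lemma card_pivot_four:
  assumes "X \<subseteq> bij_maps B \<Omega>" "A \<in> X" "e \<in> B"
    and "{fst a, fst b, fst c, fst d} \<subseteq> insert e D"
    and "dart_coeff e a + dart_coeff e b - dart_coeff e c - dart_coeff e d \<noteq> 0" (is "?g \<noteq> 0")
    and eq: "\<And>A. A \<in> X \<Longrightarrow> [dart_val A a + dart_val A b = dart_val A c + dart_val A d] (mod int v)"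
  shows "card {A' e |A'. A' \<in> X \<and> A' |` D = A |` D} \<le> 4"
proof -
  let ?S = "{x \<in> {0..<int v}. [?g * x = ?g * the (A e)] (mod int v)}"
  have finS: "finite ?S" by (rule finite_subset[of _ "{0..<int v}"]) auto
  have "A' e \<in> Some ` ?S" if A': "A' \<in> X" "A' |` D = A |` D" for A'
  proof -
    let ?F = "\<lambda>A. dart_val A a + dart_val A b - dart_val A c - dart_val A d"
    have "?F A' - ?F A = ?g * (the (A' e) - the (A e))"
      using dart_val_diff[of a e D A A'] dart_val_diff[of b e D A A']
        dart_val_diff[of c e D A A'] dart_val_diff[of d e D A A'] assms(4) A'(2)
      by (simp add: algebra_simps)
    moreover have "int v dvd ?F A'" "int v dvd ?F A"
      using eq[OF A'(1)] eq[OF assms(2)] by (auto simp: cong_iff_dvd_diff algebra_simps)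
    ultimately have "int v dvd ?g * (the (A' e) - the (A e))" by (metis dvd_diff)
    then have "[?g * the (A' e) = ?g * the (A e)] (mod int v)"
      by (simp add: cong_iff_dvd_diff right_diff_distrib)
    moreover have "the (A' e) \<in> {0..<int v}"
      using label_in[of A' e] A'(1) assms(1,3) \<Omega>_range by blast
    ultimately have "the (A' e) \<in> ?S" by blast
    then show "A' e \<in> Some ` ?S" using bij_maps_Some[of A' e] A' assms by blast
  qed
  then have "{A' e |A'. A' \<in> X \<and> A' |` D = A |` D} \<subseteq> Some ` ?S" by blast
  then have "card {A' e |A'. A' \<in> X \<and> A' |` D = A |` D} \<le> card (Some ` ?S)"
    using finS by (intro card_mono finite_imageI)
  also have "\<dots> \<le> card ?S" using finS by (rule card_image_le)
  also have "\<dots> \<le> nat \<bar>?g\<bar>" by (rule card_cong_solutions[OF assms(5)])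
  also have "\<dots> \<le> 4" by (auto simp: dart_coeff_def)
  finally show ?thesis .
qed

lemma card_pivot_one:
  assumes "X \<subseteq> bij_maps B \<Omega>" "A \<in> X" "fst q \<in> B" "fst p \<in> D"
    and eq: "\<And>A. A \<in> X \<Longrightarrow> [dart_val A q = u * dart_val A p] (mod int v)"
  shows "card {A' (fst q) |A'. A' \<in> X \<and> A' |` D = A |` D} \<le> 1"
proof -
  have "{A' (fst q) |A'. A' \<in> X \<and> A' |` D = A |` D} \<subseteq> {A (fst q)}"
  proof clarsimp
    fix A' assume A': "A' \<in> X" "A' |` D = A |` D"
    have "A (fst p) = A' (fst p)" using A'(2) assms(4) by (metis restrict_in)
    then have "dart_val A p = dart_val A' p" by (simp add: dart_val_def)
    then have "[dart_val A q = dart_val A' q] (mod int v)"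
      using eq[OF A'(1)] eq[OF assms(2)] by (metis cong_sym cong_trans)
    then have "[the (A (fst q)) = the (A' (fst q))] (mod int v)"
      by (auto simp: dart_val_def cong_minus_minus_iff split: if_splits)
    then have "the (A (fst q)) = the (A' (fst q))"
      using label_in assms A' by (intro \<Omega>_cong) auto
    then show "A' (fst q) = A (fst q)" using bij_maps_Some assms A' by (metis subsetD)
  qed
  then have "card {A' (fst q) |A'. A' \<in> X \<and> A' |` D = A |` D} \<le> card {A (fst q)}"
    by (intro card_mono) auto
  then show ?thesis by simp
qed

text \<open>Each equation supplies a pivot with at most 4 labels. The cells of \<open>b'\<close> and
  \<open>c'\<close> do not occur in the first equation, so the two pivots are different and together
  save a factor \<open>card B ^ 2\<close>.\<close>

lemma card_two_equations:
  assumes X: "X \<subseteq> bij_maps B \<Omega>" and N: "16 \<le> card B"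
    and cells: "fst ` {a, b, c, d, b', c', d'} \<subseteq> B"
    and ab: "fst a \<notin> {fst b, fst c}" "b \<noteq> c"
    and ab': "{fst b', fst c'} \<inter> {fst a, fst b, fst c, fst d} = {}" "b' \<noteq> c'"
    and eq: "\<And>A. A \<in> X \<Longrightarrow> [dart_val A a + dart_val A b = dart_val A c + dart_val A d] (mod int v)"
    and eq': "\<And>A. A \<in> X \<Longrightarrow> [dart_val A a + dart_val A b' = dart_val A c' + dart_val A d'] (mod int v)"
  shows "real (card X) \<le> 4096 / real (card B) ^ 2 * fact (card B)"
proof (cases "X = {}")
  case False
  then obtain A where A: "A \<in> X" by blast
  have AB: "A \<in> bij_maps B \<Omega>" using A X by auto
  have finX: "finite X" using X finite_bij_maps[OF finite_B finite_\<Omega>] finite_subset by blast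
  \<comment> \<open>If \<open>b = d\<close>, the equation reads \<open>val a = val c\<close>, hence \<open>a = c\<close>.\<close>
  have "b \<noteq> d"
  proof
    assume "b = d"
    then have "[dart_val A a = dart_val A c] (mod int v)"
      using eq[OF A] cong_add_rcancel by auto
    then show False using dart_val_inj[OF AB, of a c] cells ab by auto
  qed
  then obtain e where e: "e \<in> {fst b, fst c}"
    "dart_coeff e a + dart_coeff e b - dart_coeff e c - dart_coeff e d \<noteq> 0"
    using pivot_exists ab by metis
  have "b' \<noteq> d'"
  proof
    assume "b' = d'"
    then have "[dart_val A a = dart_val A c'] (mod int v)"
      using eq'[OF A] cong_add_rcancel by auto
    then show False using dart_val_inj[OF AB, of a c'] cells ab' by auto
  qed
  then obtain e' where e': "e' \<in> {fst b', fst c'}"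
    "dart_coeff e' a + dart_coeff e' b' - dart_coeff e' c' - dart_coeff e' d' \<noteq> 0"
    using pivot_exists[of a b' c' d'] ab' by auto
  define D where "D = {fst a, fst b, fst c, fst d, fst b', fst c', fst d'} - {e, e'}"
  have fD: "finite D" by (simp add: D_def)
  have ee: "e \<noteq> e'" "e \<notin> D" "e' \<notin> insert e D" "e \<in> B" "e' \<in> B"
    using e e' ab' cells by (auto simp: D_def)
  have "card D = card {fst a, fst b, fst c, fst d, fst b', fst c', fst d'} - card {e, e'}"
    unfolding D_def using e e' by (intro card_Diff_subset) auto
  also have "\<dots> \<le> 5"
    using ee card_length[of "[fst a, fst b, fst c, fst d, fst b', fst c', fst d']"] by simp
  finally have cD: "card D \<le> 6" by simp
  let ?D = "insert e' (insert e D)"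
  have DB: "D \<subseteq> B" "?D \<subseteq> B" using cells ee by (auto simp: D_def)
  \<comment> \<open>The pivot \<open>e'\<close> comes last: \<open>e\<close> may occur in the second
    equation, whereas \<open>e'\<close> does not occur in the first.\<close>
  have "card ((\<lambda>A. A |` ?D) ` X) \<le> card ((\<lambda>A. A |` insert e D) ` X) * 4"
    using e' eq' ee X
    by (intro card_restrictions_insert finX card_pivot_four[where a = a and b = b' and c = c' and d = d'])
      (auto simp: D_def)
  also have "card ((\<lambda>A. A |` insert e D) ` X) \<le> card ((\<lambda>A. A |` D) ` X) * 4"
    using e eq ee X ab' e'
    by (intro card_restrictions_insert finX card_pivot_four[where a = a and b = b and c = c and d = d])
      (auto simp: D_def)
  also have "card ((\<lambda>A. A |` D) ` X) \<le> card B ^ card D"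
    using card_restrictions_free[OF X DB(1) finite_B finite_\<Omega>] card_\<Omega> by simp
  finally have "card ((\<lambda>A. A |` ?D) ` X) \<le> card B ^ (card ?D - 2) * 16" using ee fD by simp
  \<comment> \<open>The factor 16 counts the labels of the two pivots, and at most 8 cells are
    involved, so the constant is \<open>16 * 2 ^ 8 = 4096\<close>.\<close>
  then have "real (card X) \<le> real 16 * 2 ^ 8 / real (card B) ^ 2 * fact (card B)"
    using N cD ee fD by (intro card_bij_maps_le[OF finite_B finite_\<Omega> card_\<Omega> X DB(2)]) auto
  then show ?thesis by simp
qed simp

text \<open>The labels at \<open>p1, p2, p3\<close> are free and determine those at
  \<open>q1, q2, q3\<close>. Saving three factors leaves room for a union bound over
  \<open>u\<close>; the constant is \<open>2 ^ 6\<close> for six cells.\<close>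

lemma card_three_equations:
  assumes X: "X \<subseteq> bij_maps B \<Omega>" and N: "12 \<le> card B"
    and cells: "{fst p1, fst p2, fst p3, fst q1, fst q2, fst q3} \<subseteq> B"
    and dist: "distinct [fst p1, fst p2, fst p3, fst q1, fst q2, fst q3]"
    and eq: "\<And>A p q. A \<in> X \<Longrightarrow> (p, q) \<in> {(p1, q1), (p2, q2), (p3, q3)} \<Longrightarrow>
      [dart_val A q = u * dart_val A p] (mod int v)"
  shows "real (card X) \<le> 64 / real (card B) ^ 3 * fact (card B)"
proof -
  have finX: "finite X" using X finite_bij_maps[OF finite_B finite_\<Omega>] finite_subset by blast
  let ?D = "{fst p1, fst p2, fst p3}"
  let ?R = "\<lambda>D. card ((\<lambda>A. A |` D) ` X)"
  have "?R (insert (fst q3) (insert (fst q2) (insert (fst q1) ?D))) \<le> ?R (insert (fst q2) (insert (fst q1) ?D)) * 1"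
    using X cells eq
    by (intro card_restrictions_insert finX card_pivot_one[where p = p3 and u = u]) auto
  also have "?R (insert (fst q2) (insert (fst q1) ?D)) \<le> ?R (insert (fst q1) ?D) * 1"
    using X cells eq
    by (intro card_restrictions_insert finX card_pivot_one[where p = p2 and u = u]) auto
  also have "?R (insert (fst q1) ?D) \<le> ?R ?D * 1"
    using X cells eq
    by (intro card_restrictions_insert finX card_pivot_one[where p = p1 and u = u]) auto
  also have "?R ?D \<le> card B ^ card ?D"
    using card_restrictions_free[OF X _ finite_B finite_\<Omega>] card_\<Omega> cells by simp
  finally have "?R (insert (fst q3) (insert (fst q2) (insert (fst q1) ?D))) \<le> card B ^ 3"
    using dist by (simp add: power3_eq_cube mult.assoc)
  moreover have "card (insert (fst q3) (insert (fst q2) (insert (fst q1) ?D))) = 6"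
    using dist by auto
  ultimately have "real (card X) \<le> real 1 * 2 ^ 6 / real (card B) ^ 3 * fact (card B)"
    using cells N
    by (intro card_bij_maps_le[OF finite_B finite_\<Omega> card_\<Omega> X,
          of "insert (fst q3) (insert (fst q2) (insert (fst q1) ?D))"]) auto
  then show ?thesis by simp
qed

end

section \<open>The rotation at a vertex\<close>

lemma cyclic_on_fixpoint:
  assumes "cyclic_on f S" "x \<in> S" "f x = x"
  shows "card S = 1"
proof -
  have "orbit f x = {x}" using assms(3) by (simp add: orbit_eq_singleton_iff)
  then show ?thesis using orbit_cyclic_eq3[OF assms(1,2)] by simp
qed

lemma cyclic_on_two_cycle:
  assumes "cyclic_on f S" "x \<in> S" "f (f x) = x"
  shows "card S \<le> 2"
proof -
  have "y \<in> {x, f x}" if "y \<in> orbit f x" for y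
    using that by induction (use assms(3) in auto)
  then have "S \<subseteq> {x, f x}" using orbit_cyclic_eq3[OF assms(1,2)] by blast
  then have "card S \<le> card {x, f x}" by (intro card_mono) auto
  also have "\<dots> \<le> 2" by (simp add: card_insert_if)
  finally show ?thesis .
qed

locale array_rotation =
  fixes B :: "cell set" and \<alpha>r \<alpha>c :: "cell \<Rightarrow> cell"
  assumes finite_cells: "finite B"
    and compat: "compatible_orderings B \<alpha>r \<alpha>c"
    and row_card: "c \<in> B \<Longrightarrow> 3 \<le> card (row_of B (fst c))"
    and col_card: "c \<in> B \<Longrightarrow> 3 \<le> card (col_of B (snd c))"
begin

definition darts :: "(cell \<times> bool) set" where
  "darts = B \<times> UNIV"

text \<open>Written in terms of darts, \<open>rho0\<close> does not depend on the entries of the array.\<close>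

definition rot :: "cell \<times> bool \<Rightarrow> cell \<times> bool" where
  "rot p = (if snd p then \<alpha>r (fst p) else \<alpha>c (fst p), \<not> snd p)"

lemma darts_iff: "p \<in> darts \<longleftrightarrow> fst p \<in> B"
  by (cases p) (simp add: darts_def)

lemma finite_darts: "finite darts"
  using finite_cells by (simp add: darts_def)

lemma card_darts: "card darts = 2 * card B"
  by (simp add: darts_def card_cartesian_product)

lemma neg_in [simp]: "neg p \<in> darts \<longleftrightarrow> p \<in> darts"
  by (simp add: darts_iff)

lemma \<alpha>r_permutes: "\<alpha>r permutes B" and \<alpha>c_permutes: "\<alpha>c permutes B"
  using compat by (auto simp: compatible_orderings_def row_ordering_def col_ordering_def)

lemma \<alpha>_in [simp]: "\<alpha>r c \<in> B \<longleftrightarrow> c \<in> B" "\<alpha>c c \<in> B \<longleftrightarrow> c \<in> B"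
  by (simp_all add: permutes_in_image[OF \<alpha>r_permutes] permutes_in_image[OF \<alpha>c_permutes])

lemma row_cyclic: "c \<in> B \<Longrightarrow> cyclic_on \<alpha>r (row_of B (fst c))"
  and col_cyclic: "c \<in> B \<Longrightarrow> cyclic_on \<alpha>c (col_of B (snd c))"
  using compat by (auto simp: compatible_orderings_def row_ordering_def col_ordering_def)

lemma fst_\<alpha>r: "c \<in> B \<Longrightarrow> fst (\<alpha>r c) = fst c"
  using cyclic_on_inI[OF row_cyclic, of c c] by (simp add: row_of_def)

lemma snd_\<alpha>c: "c \<in> B \<Longrightarrow> snd (\<alpha>c c) = snd c"
  using cyclic_on_inI[OF col_cyclic, of c c] by (simp add: col_of_def)

lemma \<alpha>r_neq: "c \<in> B \<Longrightarrow> \<alpha>r c \<noteq> c" "c \<in> B \<Longrightarrow> \<alpha>r (\<alpha>r c) \<noteq> c"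
  using cyclic_on_fixpoint[OF row_cyclic, of c c] cyclic_on_two_cycle[OF row_cyclic, of c c]
    row_card[of c] by (auto simp: row_of_def)

lemma \<alpha>c_neq: "c \<in> B \<Longrightarrow> \<alpha>c c \<noteq> c" "c \<in> B \<Longrightarrow> \<alpha>c (\<alpha>c c) \<noteq> c"
  using cyclic_on_fixpoint[OF col_cyclic, of c c] cyclic_on_two_cycle[OF col_cyclic, of c c]
    col_card[of c] by (auto simp: col_of_def)

text \<open>\<open>\<alpha>r\<close> preserves the row and \<open>\<alpha>c\<close> the column, so a
  common image of \<open>c\<close> would be \<open>c\<close> itself. The next two lemmas rest on the
  same remark.\<close>

lemma \<alpha>r_neq_\<alpha>c: "c \<in> B \<Longrightarrow> \<alpha>r c \<noteq> \<alpha>c c"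
  using \<alpha>r_neq(1) fst_\<alpha>r snd_\<alpha>c by (metis prod_eqI)

lemma \<alpha>c_\<alpha>r_neq: "c \<in> B \<Longrightarrow> \<alpha>c (\<alpha>r c) \<noteq> c"
  using \<alpha>r_neq(1)[of c] fst_\<alpha>r[of c] snd_\<alpha>c[of "\<alpha>r c"] by (metis \<alpha>_in(1) prod_eqI)

lemma \<alpha>r_\<alpha>c_neq: "c \<in> B \<Longrightarrow> \<alpha>r (\<alpha>c c) \<noteq> c"
  using \<alpha>c_neq(1)[of c] fst_\<alpha>r[of "\<alpha>c c"] snd_\<alpha>c[of c] by (metis \<alpha>_in(2) prod_eqI)

lemma rot_in [simp]: "rot p \<in> darts \<longleftrightarrow> p \<in> darts"
  by (simp add: darts_iff rot_def)

lemma rot_inj: "rot p = rot q \<longleftrightarrow> p = q"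
  using inj_eq[OF permutes_inj[OF \<alpha>r_permutes]] inj_eq[OF permutes_inj[OF \<alpha>c_permutes]]
  by (cases p; cases q) (auto simp: rot_def)

lemma rot_surj: "p \<in> darts \<Longrightarrow> \<exists>q\<in>darts. rot q = p"
proof -
  assume p: "p \<in> darts"
  have "inj_on rot darts" by (simp add: inj_on_def rot_inj)
  then have "rot ` darts = darts" using finite_darts by (intro endo_inj_surj) auto
  then show ?thesis using p by (metis imageE)
qed

text \<open>Compatibility enters here: two steps of \<open>rot\<close> from
  \<open>(c, False)\<close> lead to \<open>((\<alpha>r \<circ> \<alpha>c) c, False)\<close>, so the
  single cycle of \<open>\<alpha>r \<circ> \<alpha>c\<close> makes \<open>rot\<close> a single cycle
  on all darts.\<close>

lemma rot_induct [consumes 2, case_names step]: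
  assumes "p \<in> darts" "q \<in> darts" "Q p"
    and step: "\<And>p. p \<in> darts \<Longrightarrow> Q p \<Longrightarrow> Q (rot p)"
  shows "Q q"
proof -
  have cyc: "cyclic_on (\<alpha>r \<circ> \<alpha>c) B" using compat by (simp add: compatible_orderings_def)
  have ex: "\<exists>c\<in>B. Q (c, False)"
  proof (cases "snd p")
    case True
    then have "rot p = (\<alpha>r (fst p), False)" by (simp add: rot_def)
    then show ?thesis using step[of p] assms by (metis \<alpha>_in(1) darts_iff)
  next
    case False then show ?thesis using assms by (metis darts_iff prod.collapse)
  qed
  then obtain c where c: "c \<in> B" "Q (c, False)" by blast
  have step2: "Q ((\<alpha>r \<circ> \<alpha>c) x, False)" if "x \<in> B" "Q (x, False)" for x
    using step[OF _ step[of "(x, False)"]] that by (simp add: darts_iff rot_def)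
  have "x \<in> B \<and> Q (x, False)" if "x \<in> orbit (\<alpha>r \<circ> \<alpha>c) c" for x
    using that by induction (use c step2 in auto)
  then have all: "Q (x, False)" if "x \<in> B" for x
    using orbit_cyclic_eq3[OF cyc c(1)] that by simp
  show ?thesis
  proof (cases "snd q")
    case True
    obtain q' where q': "q' \<in> darts" "rot q' = q" using rot_surj assms by blast
    then have "q' = (fst q', False)" using True by (auto simp: rot_def prod_eq_iff)
    then show ?thesis using all[of "fst q'"] q' step[of q'] darts_iff by metis
  next
    case False then show ?thesis using all assms darts_iff by (metis prod.collapse)
  qed
qed

section \<open>Dihedral symmetries of the rotation\<close>

text \<open>The flag distinguishes rotations from reflections of the cycle \<open>rot\<close>.\<close>

definition dihedral :: "bool \<Rightarrow> (cell \<times> bool \<Rightarrow> cell \<times> bool) \<Rightarrow> bool" where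
  "dihedral \<epsilon> S \<longleftrightarrow> S ` darts \<subseteq> darts \<and> inj_on S darts \<and>
     (\<forall>p\<in>darts. if \<epsilon> then S (rot p) = rot (S p) else rot (S (rot p)) = S p)"

lemma dihedral_in: "dihedral \<epsilon> S \<Longrightarrow> p \<in> darts \<Longrightarrow> S p \<in> darts"
  by (auto simp: dihedral_def)

text \<open>Agreement at one dart propagates along the cycle \<open>rot\<close>. A dihedral map of
  known flag is thus determined by a single value, which gives the count below.\<close>

lemma dihedral_agree:
  assumes "dihedral \<epsilon> S" "dihedral \<epsilon> S'" "p \<in> darts" "S p = S' p" "q \<in> darts"
  shows "S q = S' q"
proof (rule rot_induct[where Q = "\<lambda>x. S x = S' x", OF assms(3,5,4)])
  fix p assume "p \<in> darts" "S p = S' p"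
  then show "S (rot p) = S' (rot p)" using assms(1,2)
    by (cases \<epsilon>) (auto simp: dihedral_def, metis rot_inj)
qed

lemma card_dihedral:
  assumes "B \<noteq> {}"
  shows "card {S \<in> darts \<rightarrow>\<^sub>E darts. dihedral \<epsilon> S} \<le> card darts"
proof -
  obtain p where p: "p \<in> darts" using assms by (auto simp: darts_def)
  have "inj_on (\<lambda>S. S p) {S \<in> darts \<rightarrow>\<^sub>E darts. dihedral \<epsilon> S}"
  proof (rule inj_onI)
    fix S S' assume "S \<in> {S \<in> darts \<rightarrow>\<^sub>E darts. dihedral \<epsilon> S}"
      "S' \<in> {S \<in> darts \<rightarrow>\<^sub>E darts. dihedral \<epsilon> S}" "S p = S' p"
    then show "S = S'" using dihedral_agree[OF _ _ p] by (intro PiE_ext[of S darts _ S']) auto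
  qed
  then show ?thesis using p finite_darts by (intro card_inj_on_le[of "\<lambda>S. S p"]) auto
qed

text \<open>A rotation other than the identity fixes no dart, so it would negate both
  \<open>p\<close> and \<open>rot p\<close>, forcing \<open>\<alpha>r c = \<alpha>c c\<close>. A
  reflection would make \<open>c\<close> return to itself after two steps: two row steps or two
  column steps are excluded by sizes of at least 3, one of each by the change of row and
  column.\<close>

lemma dihedral_cell_fixed:
  assumes "dihedral \<epsilon> S" "\<epsilon> \<Longrightarrow> \<exists>q\<in>darts. S q \<noteq> q" "p \<in> darts" "fst (S p) = fst p"
  shows "fst (S (rot p)) \<noteq> fst (rot p)"
proof
  assume fix_rot: "fst (S (rot p)) = fst (rot p)"
  obtain c s where c: "p = (c, s)" "c \<in> B" using assms(3) by (cases p) (simp add: darts_iff)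
  have id: "dihedral True (\<lambda>p. p)" by (auto simp: dihedral_def)
  show False
  proof (cases \<epsilon>)
    case True
    then have S: "dihedral True S" using assms(1) by simp
    have "S x \<noteq> x" if "x \<in> darts" for x
      using dihedral_agree[OF S id that] assms(2)[OF True] by blast
    then have "S p \<noteq> p" "S (rot p) \<noteq> rot p" using assms(3) by simp_all
    then have "S p = neg p" "S (rot p) = neg (rot p)"
      using assms fix_rot by (auto simp: fst_eq_cases)
    then have "rot (neg p) = neg (rot p)" using assms(1,3) True by (simp add: dihedral_def)
    then show False using \<alpha>r_neq_\<alpha>c[OF c(2)] c by (cases s) (auto simp: rot_def neg_def)
  next
    case False
    then have "rot (S (rot p)) = S p" using assms(1,3) by (simp add: dihedral_def)
    moreover have "S p = p \<or> S p = neg p" "S (rot p) = rot p \<or> S (rot p) = neg (rot p)"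
      using assms fix_rot by (auto simp: fst_eq_cases)
    ultimately show False
      using \<alpha>r_neq[OF c(2)] \<alpha>c_neq[OF c(2)] \<alpha>c_\<alpha>r_neq[OF c(2)] \<alpha>r_\<alpha>c_neq[OF c(2)]
      unfolding c(1) by (cases s) (auto simp only: rot_def neg_def fst_conv snd_conv prod.inject simp_thms if_True if_False)
  qed
qed

text \<open>\<open>rot\<close> injects the darts whose cell is kept into those whose cell is moved,
  so at least half of the \<open>2 * card B\<close> darts are moved.\<close>

lemma card_moved_darts:
  assumes "dihedral \<epsilon> S" "\<epsilon> \<Longrightarrow> \<exists>q\<in>darts. S q \<noteq> q"
  shows "card B \<le> card {p \<in> darts. fst (S p) \<noteq> fst p}"
proof -
  let ?M = "{p \<in> darts. fst (S p) \<noteq> fst p}"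
  have "rot ` (darts - ?M) \<subseteq> ?M" using dihedral_cell_fixed[OF assms] by auto
  moreover have "inj_on rot (darts - ?M)" by (simp add: inj_on_def rot_inj)
  ultimately have "card (darts - ?M) \<le> card ?M"
    using finite_darts by (intro card_inj_on_le[of rot]) auto
  moreover have "card (darts - ?M) = card darts - card ?M"
    using finite_darts by (intro card_Diff_subset) auto
  ultimately show ?thesis using card_darts by simp
qed

section \<open>Choosing darts that avoid given cells\<close>

lemma card_darts_into_cells:
  assumes "f ` darts \<subseteq> darts" "inj_on f darts" "finite D"
  shows "card {p \<in> darts. fst (f p) \<in> D} \<le> 2 * card D"
proof -
  have "card {p \<in> darts. fst (f p) \<in> D} \<le> card (D \<times> (UNIV :: bool set))"
  proof (rule card_inj_on_le[of f])
    show "inj_on f {p \<in> darts. fst (f p) \<in> D}"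
      using assms(2) by (rule inj_on_subset) auto
    show "f ` {p \<in> darts. fst (f p) \<in> D} \<subseteq> D \<times> UNIV"
      by (simp add: image_subset_iff mem_Times_iff)
  qed (simp add: assms(3))
  then show ?thesis by (simp add: card_cartesian_product)
qed

text \<open>Each of \<open>f\<close> and \<open>S\<close> sends at most \<open>2 * card D\<close>
  darts into \<open>D\<close>, being injective on darts, of which a cell has two.\<close>

lemma exists_dart_avoiding:
  assumes "dihedral \<epsilon> S" "f ` darts \<subseteq> darts" "inj_on f darts" "finite D" "4 * card D < card F" "F \<subseteq> darts"
  obtains p where "p \<in> F" "fst (f p) \<notin> D" "fst (S p) \<notin> D"
proof -
  let ?G = "{p \<in> darts. fst (f p) \<in> D} \<union> {p \<in> darts. fst (S p) \<in> D}"
  have "card ?G \<le> 2 * card D + 2 * card D"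
    using card_darts_into_cells[OF assms(2-4)] card_darts_into_cells[of S D] assms(1,4)
    by (intro order.trans[OF card_Un_le] add_mono) (auto simp: dihedral_def)
  then have "\<not> F \<subseteq> ?G"
    using assms(5) finite_darts card_mono[of ?G F] by fastforce
  then show ?thesis using that assms(6) by blast
qed

lemma three_moved_darts:
  assumes "dihedral \<epsilon> S" "\<epsilon> \<Longrightarrow> \<exists>q\<in>darts. S q \<noteq> q" "17 \<le> card B"
  obtains p1 p2 p3 where "{p1, p2, p3} \<subseteq> darts"
    "distinct [fst p1, fst p2, fst p3, fst (S p1), fst (S p2), fst (S p3)]"
proof -
  let ?M = "{p \<in> darts. fst (S p) \<noteq> fst p}"
  \<comment> \<open>The threshold 17 exceeds \<open>4 * 4\<close>: the third dart has to avoid the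
    four cells used by the first two.\<close>
  have M: "17 \<le> card ?M" using card_moved_darts[OF assms(1,2)] assms(3) by linarith
  have pick: thesis' if "finite D" "card D \<le> 4"
    "\<And>p. p \<in> ?M \<Longrightarrow> fst p \<notin> D \<Longrightarrow> fst (S p) \<notin> D \<Longrightarrow> thesis'" for D thesis'
    using exists_dart_avoiding[OF assms(1), of "\<lambda>p. p" D ?M] M that by fastforce
  obtain p1 where p1: "p1 \<in> ?M" by (rule pick[of "{}"]) auto
  obtain p2 where p2: "p2 \<in> ?M" "fst p2 \<notin> {fst p1, fst (S p1)}" "fst (S p2) \<notin> {fst p1, fst (S p1)}"
    by (rule pick[of "{fst p1, fst (S p1)}"]) (auto simp: card_insert_if)
  obtain p3 where p3: "p3 \<in> ?M" "fst p3 \<notin> {fst p1, fst (S p1), fst p2, fst (S p2)}"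
    "fst (S p3) \<notin> {fst p1, fst (S p1), fst p2, fst (S p2)}"
    by (rule pick[of "{fst p1, fst (S p1), fst p2, fst (S p2)}"]) (auto simp: card_insert_if)
  show ?thesis using p1 p2 p3 by (intro that[of p1 p2 p3]) auto
qed

end

section \<open>Counting the arrays with a given trace\<close>

locale random_array = array_rotation B \<alpha>r \<alpha>c + labelling B \<Omega> v
  for B \<alpha>r \<alpha>c \<Omega> v
begin

text \<open>The traces of a nontrivial automorphism \<open>\<sigma>\<close> that fixes 0: \<open>S\<close> and \<open>M p\<close> describe
  its action on the edges at 0 and at the vertex \<open>val p\<close>. The congruence computes
  \<open>\<sigma> (val p + val q)\<close> along the two paths through \<open>val p\<close> and \<open>val q\<close>.\<close>

definition aut_trace :: "bool \<Rightarrow> (cell \<times> bool \<Rightarrow> cell \<times> bool) \<Rightarrow>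
    (cell \<times> bool \<Rightarrow> cell \<times> bool \<Rightarrow> cell \<times> bool) \<Rightarrow> (cell \<rightharpoonup> int) \<Rightarrow> bool" where
  "aut_trace \<epsilon> S M A \<longleftrightarrow>
     (\<forall>p\<in>darts. dihedral \<epsilon> (M p) \<and> M p (neg p) = neg (S p)) \<and>
     (\<forall>p\<in>darts. \<forall>q\<in>darts. [dart_val A (S p) + dart_val A (M p q)
        = dart_val A (S q) + dart_val A (M q p)] (mod int v)) \<and>
     ((\<forall>p\<in>darts. \<forall>q\<in>darts. M p q = S q) \<longrightarrow>
        (\<exists>u\<in>{0..<int v}. \<forall>p\<in>darts. [dart_val A (S p) = u * dart_val A p] (mod int v)))"

text \<open>Since \<open>M p\<close> is dihedral with its value at \<open>neg p\<close> prescribed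
  by \<open>S\<close>, all arrays with a trace for \<open>S\<close> share the same \<open>M\<close>
  on darts. They therefore satisfy the same linear equations, whose shape depends on whether every
  \<open>M p\<close> agrees with \<open>S\<close>.\<close>

lemma card_aut_trace:
  assumes S: "dihedral \<epsilon> S" "\<epsilon> \<Longrightarrow> \<exists>q\<in>darts. S q \<noteq> q"
    and N: "17 \<le> card B" and v: "v \<le> 3 * card B"
  shows "real (card {A \<in> bij_maps B \<Omega>. \<exists>M. aut_trace \<epsilon> S M A}) \<le> 4096 / real (card B) ^ 2 * fact (card B)"
    (is "real (card ?X) \<le> _")
proof (cases "?X = {}")
  case False
  then obtain A0 M where "A0 \<in> ?X" and M0: "aut_trace \<epsilon> S M A0" by blast
  have M: "dihedral \<epsilon> (M p)" "M p (neg p) = neg (S p)" if "p \<in> darts" for p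
    using M0 that by (auto simp: aut_trace_def)
  have unique: "M' p q = M p q" if "aut_trace \<epsilon> S M' A" "p \<in> darts" "q \<in> darts" for M' A p q
  proof (rule dihedral_agree[of \<epsilon> "M' p" "M p" "neg p"])
    show "dihedral \<epsilon> (M' p)" "M' p (neg p) = M p (neg p)" using that M by (auto simp: aut_trace_def)
  qed (use that M in auto)
  have eq: "[dart_val A (S p) + dart_val A (M p q) = dart_val A (S q) + dart_val A (M q p)] (mod int v)"
    if A: "A \<in> ?X" and pq: "p \<in> darts" "q \<in> darts" for A p q
  proof -
    obtain M' where M': "aut_trace \<epsilon> S M' A" using A by blast
    then have "[dart_val A (S p) + dart_val A (M' p q) = dart_val A (S q) + dart_val A (M' q p)] (mod int v)"
      using pq unfolding aut_trace_def by blast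
    then show ?thesis by (simp only: unique[OF M' pq] unique[OF M' pq(2,1)])
  qed
  have X: "?X \<subseteq> bij_maps B \<Omega>" by auto
  have cell: "fst p \<in> B" if "p \<in> darts" for p using that by (simp add: darts_iff)
  show ?thesis
  proof (cases "\<forall>p\<in>darts. \<forall>q\<in>darts. M p q = S q")
    case False
    then obtain p q0 where p: "p \<in> darts" "q0 \<in> darts" "M p q0 \<noteq> S q0" by blast
    \<comment> \<open>If \<open>M p\<close> and \<open>S\<close> differ at one dart, they differ at
      all, so the hypotheses \<open>b \<noteq> c\<close> and \<open>b' \<noteq> c'\<close> of
      \<open>card_two_equations\<close> hold for any choice of \<open>q\<close> and
      \<open>q'\<close>.\<close>
    have neq: "M p q \<noteq> S q" if "q \<in> darts" for q
      using dihedral_agree[OF M(1)[OF p(1)] S(1) that _ p(2)] p(3) by blast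
    have avoid: "\<exists>q\<in>darts. fst (M p q) \<notin> D \<and> fst (S q) \<notin> D" if "finite D" "card D \<le> 4" for D
    proof -
      have "4 * card D < card darts" using that N card_darts by simp
      then show ?thesis
        using exists_dart_avoiding[OF S(1), of "M p" D darts] M(1)[OF p(1)] that
        by (metis dihedral_def order_refl)
    qed
    obtain q where q: "q \<in> darts" "fst (M p q) \<notin> {fst (S p)}" "fst (S q) \<notin> {fst (S p)}"
      using avoid[of "{fst (S p)}"] by auto
    let ?D = "{fst (S p), fst (M p q), fst (S q), fst (M q p)}"
    have cD: "card ?D \<le> 4"
      using card_length[of "[fst (S p), fst (M p q), fst (S q), fst (M q p)]"] by simp
    \<comment> \<open>\<open>q'\<close> avoids all four cells of the first equation, so that the
      second one has a pivot outside it.\<close>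
    obtain q' where q': "q' \<in> darts" "fst (M p q') \<notin> ?D" "fst (S q') \<notin> ?D"
      using avoid[OF _ cD] by blast
    have "fst ` {S p, M p q, S q, M q p, M p q', S q', M q' p} \<subseteq> B"
      using p(1) q(1) q'(1) dihedral_in[OF M(1)] dihedral_in[OF S(1)] cell by auto
    then show ?thesis
      using N q q' neq p(1)
      by (intro card_two_equations[OF X, of "S p" "M p q" "S q" "M q p" "M p q'" "S q'" "M q' p"] eq) auto
  next
    case True
    obtain p1 p2 p3 where ps: "{p1, p2, p3} \<subseteq> darts"
      "distinct [fst p1, fst p2, fst p3, fst (S p1), fst (S p2), fst (S p3)]"
      using three_moved_darts[OF S N] by metis
    let ?Y = "\<lambda>u. {A \<in> bij_maps B \<Omega>. \<forall>p\<in>darts. [dart_val A (S p) = u * dart_val A p] (mod int v)}"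
    \<comment> \<open>The at most \<open>3 * card B\<close> values of \<open>u\<close> cost one of
      the three saved factors, and \<open>64 * 3\<close> stays below 4096.\<close>
    have "?X \<subseteq> (\<Union>u\<in>{0..<int v}. ?Y u)"
    proof
      fix A assume A: "A \<in> ?X"
      then obtain M' where M': "aut_trace \<epsilon> S M' A" by blast
      then have "\<forall>p\<in>darts. \<forall>q\<in>darts. M' p q = S q" using unique[OF M'] True by auto
      then have "\<exists>u\<in>{0..<int v}. \<forall>p\<in>darts. [dart_val A (S p) = u * dart_val A p] (mod int v)"
        using M' unfolding aut_trace_def by blast
      then show "A \<in> (\<Union>u\<in>{0..<int v}. ?Y u)" using A by blast
    qed
    then have "card ?X \<le> (\<Sum>u\<in>{0..<int v}. card (?Y u))"
      by (intro order.trans[OF card_mono card_UN_le])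
        (auto intro: finite_subset[OF _ finite_bij_maps[OF finite_B finite_\<Omega>]])
    then have "real (card ?X) \<le> real (\<Sum>u\<in>{0..<int v}. card (?Y u))"
      by (rule of_nat_mono)
    also have "\<dots> = (\<Sum>u\<in>{0..<int v}. real (card (?Y u)))" by (rule of_nat_sum)
    also have "\<dots> \<le> (\<Sum>u\<in>{0..<int v}. 64 / real (card B) ^ 3 * fact (card B))"
    proof (rule sum_mono)
      fix u
      have "{fst p1, fst p2, fst p3, fst (S p1), fst (S p2), fst (S p3)} \<subseteq> B"
        using ps(1) dihedral_in[OF S(1)] cell by auto
      then show "real (card (?Y u)) \<le> 64 / real (card B) ^ 3 * fact (card B)"
        using N ps by (intro card_three_equations[OF _ _ _ ps(2), where u = u]) auto
    qed
    also have "\<dots> = 64 * (real v / real (card B) ^ 3) * fact (card B)" by simp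
    also have "\<dots> \<le> 64 * (3 / real (card B) ^ 2) * fact (card B)"
    proof (intro mult_right_mono mult_left_mono)
      have "real v / real (card B) ^ 3 \<le> (3 * real (card B)) / real (card B) ^ 3"
        using v by (intro divide_right_mono) auto
      also have "\<dots> = 3 / real (card B) ^ 2"
        using N by (simp add: power2_eq_square power3_eq_cube)
      finally show "real v / real (card B) ^ 3 \<le> 3 / real (card B) ^ 2" .
    qed auto
    also have "\<dots> \<le> 4096 / real (card B) ^ 2 * fact (card B)"
      by (intro mult_right_mono) (auto simp: divide_right_mono)
    finally show ?thesis .
  qed
next
  case True
  show ?thesis unfolding True by simp
qed

end

section \<open>Local action of automorphisms\<close>

lemma Jsub_iff:
  assumes "t dvd v" "0 < v"
  shows "x \<in> Jsub v t \<longleftrightarrow> x \<in> Zmod v \<and> int (v div t) dvd x"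
proof -
  let ?w = "int (v div t)"
  have w: "?w dvd int v" using assms(1) by (metis dvd_div_mult_self dvd_triv_left int_dvd_int_iff)
  have w0: "0 < ?w" using assms by (auto simp: dvd_def)
  show ?thesis
  proof
    assume "x \<in> Jsub v t"
    then obtain y where "x = (?w * y) mod int v" by (auto simp: Jsub_def)
    then show "x \<in> Zmod v \<and> ?w dvd x" using assms(2) w by (simp add: Zmod_def dvd_mod)
  next
    assume x: "x \<in> Zmod v \<and> ?w dvd x"
    then obtain y where y: "x = ?w * y" by (auto simp: dvd_def)
    have "0 \<le> y" using x y w0 by (auto simp: Zmod_def zero_le_mult_iff)
    moreover have "y \<le> ?w * y" using w0 calculation by (simp add: mult_le_cancel_right1)
    ultimately have "y \<in> Zmod v" using x y by (auto simp: Zmod_def)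
    moreover have "x = (?w * y) mod int v" using x y by (simp add: Zmod_def)
    ultimately show "x \<in> Jsub v t" by (auto simp: Jsub_def)
  qed
qed

text \<open>\<open>parts\<close> keeps 1 and 2 from being multiples of \<open>v div t\<close>, which
  is used to show that a uniform action is a multiplication.\<close>

locale Archdeacon_array = random_array B \<alpha>r \<alpha>c \<Omega> v
  for B \<alpha>r \<alpha>c \<Omega> v +
  fixes t :: nat
  assumes t_dvd: "t dvd v" and v_pos: "0 < v" and parts: "2 < v div t"
    and nonadjacent_iff: "x \<in> Zmod v \<Longrightarrow>
      x \<notin> Jsub v t \<longleftrightarrow> (\<exists>y\<in>\<Omega>. x = y \<or> x = (- y) mod int v)"
begin

abbreviation w :: int where "w \<equiv> int (v div t)"

lemma w_dvd: "w dvd int v"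
  using t_dvd by (metis dvd_div_mult_self dvd_triv_left int_dvd_int_iff)

lemma w_dvd_mod [simp]: "w dvd x mod int v \<longleftrightarrow> w dvd x"
  using w_dvd by (simp add: dvd_mod_iff)

lemma mod_in_Zmod [simp]: "x mod int v \<in> Zmod v"
  using v_pos by (simp add: Zmod_def)

lemma mod_Zmod: "x \<in> Zmod v \<Longrightarrow> x mod int v = x"
  by (simp add: Zmod_def)

lemma mod_in_Jsub: "x mod int v \<in> Jsub v t \<longleftrightarrow> w dvd x"
  using Jsub_iff[OF t_dvd v_pos] by simp

lemma arc_iff: "(x, y) \<in> parcs (multipartite_graph v t) \<longleftrightarrow> x \<in> Zmod v \<and> y \<in> Zmod v \<and> \<not> w dvd y - x"
  by (simp add: multipartite_graph_def mod_in_Jsub)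

end

section \<open>The action of an automorphism on the darts at each vertex\<close>

locale labelled_Archdeacon_array = Archdeacon_array +
  fixes A :: pf_array
  assumes A: "A \<in> bij_maps B \<Omega>"
begin

abbreviation val :: "cell \<times> bool \<Rightarrow> int" where "val \<equiv> dart_val A"

abbreviation \<rho> where
  "\<rho> \<equiv> snd (Archdeacon_embedding v t A (entry_ordering A \<alpha>r) (entry_ordering A \<alpha>c))"

lemma val_not_dvd: "p \<in> darts \<Longrightarrow> \<not> w dvd val p"
proof -
  assume "p \<in> darts"
  then have \<Omega>: "the (A (fst p)) \<in> \<Omega>" using label_in[OF A] by (simp add: darts_iff)
  then have "the (A (fst p)) \<in> Zmod v" using \<Omega>_range by (auto simp: Zmod_def)
  then have "the (A (fst p)) \<notin> Jsub v t" using nonadjacent_iff \<Omega> by blast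
  then have "\<not> w dvd the (A (fst p))"
    using Jsub_iff[OF t_dvd v_pos] \<open>_ \<in> Zmod v\<close> by simp
  then show ?thesis by (simp add: dart_val_def)
qed

lemma val_surj:
  assumes "\<not> w dvd x"
  obtains p where "p \<in> darts" "[x = val p] (mod int v)"
proof -
  have "x mod int v \<notin> Jsub v t" using assms by (simp add: mod_in_Jsub)
  then obtain y where y: "y \<in> \<Omega>" "x mod int v = y \<or> x mod int v = (- y) mod int v"
    using nonadjacent_iff by auto
  then obtain c where c: "c \<in> B" "A c = Some y" using A by (auto simp: bij_maps_def ran_def)
  have y_mod: "y mod int v = y" using y(1) \<Omega>_range by auto
  have "[x = val (c, True)] (mod int v) \<or> [x = val (c, False)] (mod int v)"
    using y c y_mod by (auto simp: cong_def dart_val_def)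
  then show ?thesis using that[of "(c, True)"] that[of "(c, False)"] c(1) by (auto simp only: darts_iff fst_conv)
qed

lemma val_inj: "p \<in> darts \<Longrightarrow> q \<in> darts \<Longrightarrow> [val p = val q] (mod int v) \<Longrightarrow> p = q"
  using dart_val_inj[OF A] by (simp add: darts_iff)

lemma entry_ordering_label:
  assumes "c \<in> B"
  shows "entry_ordering A \<alpha> (the (A c)) = the (A (\<alpha> c))"
proof -
  have "position A (the (A c)) = c" unfolding position_def
  proof (rule the_equality)
    show "A c = Some (the (A c))" using bij_maps_Some[OF A assms] .
    fix d assume d: "A d = Some (the (A c))"
    then have "d \<in> B" using A by (auto simp: bij_maps_def)
    then show "d = c" using inj_onD[OF bij_maps_inj_on(1)[OF finite_B card_\<Omega> A], of d c] d assms
      by simp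
  qed
  then show ?thesis by (simp add: entry_ordering_def)
qed

lemma rho0_val:
  assumes "p \<in> darts"
  shows "rho0 v A (entry_ordering A \<alpha>r) (entry_ordering A \<alpha>c) (val p mod int v) = val (rot p) mod int v"
proof -
  obtain c s where p: "p = (c, s)" "c \<in> B" using assms by (cases p) (simp add: darts_iff)
  have ran: "ran A = \<Omega>" using A by (simp add: bij_maps_def)
  have \<Omega>_mod: "the (A c) mod int v = the (A c)" if "c \<in> B" for c
    using label_in[OF A that] \<Omega>_range by auto
  have \<Omega>c: "the (A c) \<in> \<Omega>" using label_in[OF A p(2)] .
  show ?thesis
  proof (cases s)
    case True
    then show ?thesis using p ran \<Omega>c \<Omega>_mod[OF p(2)]
      by (simp add: rho0_def dart_val_def rot_def entry_ordering_label)
  next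
    case False
    \<comment> \<open>The negative of a label lies outside \<open>\<Omega>\<close>, so
      \<open>rho0\<close> takes its second branch, the column step.\<close>
    have "(- the (A c)) mod int v \<notin> \<Omega>"
      using \<Omega>_anti[of "(- the (A c)) mod int v" "the (A c)"] \<Omega>c by (auto simp: cong_def)
    then show ?thesis using p ran False \<Omega>_mod[of c] \<Omega>_mod[of "\<alpha>c c"]
      by (simp add: rho0_def dart_val_def rot_def entry_ordering_label mod_minus_eq)
  qed
qed

lemma arc_val:
  assumes "x \<in> Zmod v" "p \<in> darts"
  shows "(x, (x + val p) mod int v) \<in> parcs (multipartite_graph v t)"
proof -
  have "w dvd (x + val p) mod int v - x \<longleftrightarrow> w dvd ((x + val p) mod int v - x) mod int v"
    by simp
  also have "\<dots> \<longleftrightarrow> w dvd val p" by (simp add: mod_diff_left_eq)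
  finally show ?thesis using assms val_not_dvd by (simp add: arc_iff)
qed

lemma \<rho>_val:
  assumes "x \<in> Zmod v" "p \<in> darts"
  shows "\<rho> (x, (x + val p) mod int v) = (x, (x + val (rot p)) mod int v)"
proof -
  have "((x + val p) mod int v - x) mod int v = val p mod int v" by (simp add: mod_diff_left_eq)
  then show ?thesis using arc_val[OF assms] rho0_val[OF assms(2)]
    by (simp add: Archdeacon_embedding_def mod_add_right_eq)
qed

text \<open>\<open>\<sigma>\<close> preserves arcs, so it sends the arcs at \<open>x\<close> to arcs
  at \<open>\<sigma> x\<close>; on darts this is the map \<open>M x\<close>. Commuting with
  \<open>\<rho>\<close> or inverting it turns into the same relation with \<open>rot\<close>, with
  one flag \<open>\<epsilon>\<close> for all vertices.\<close>

lemma local_action: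
  assumes "\<sigma> \<in> embedding_Aut (Archdeacon_embedding v t A (entry_ordering A \<alpha>r) (entry_ordering A \<alpha>c))"
  obtains \<epsilon> M where "\<And>x. x \<in> Zmod v \<Longrightarrow> dihedral \<epsilon> (M x)"
    "\<And>x p. x \<in> Zmod v \<Longrightarrow> p \<in> darts \<Longrightarrow> [\<sigma> ((x + val p) mod int v) = \<sigma> x + val (M x p)] (mod int v)"
proof -
  let ?G = "multipartite_graph v t"
  have "graph_automorphism ?G \<sigma>"
    and comm: "(\<forall>e\<in>parcs ?G. map_prod \<sigma> \<sigma> (\<rho> e) = \<rho> (map_prod \<sigma> \<sigma> e)) \<or>
       (\<forall>e\<in>parcs ?G. map_prod \<sigma> \<sigma> (\<rho> e) = inv \<rho> (map_prod \<sigma> \<sigma> e))"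
    using assms by (auto simp: embedding_Aut_def Archdeacon_embedding_def)
  then have perm: "\<sigma> permutes Zmod v"
    and arcs: "\<And>x y. x \<in> Zmod v \<Longrightarrow> y \<in> Zmod v \<Longrightarrow> (\<sigma> x, \<sigma> y) \<in> parcs ?G \<longleftrightarrow> (x, y) \<in> parcs ?G"
    by (auto simp: graph_automorphism_def multipartite_graph_def)
  have \<sigma>_in: "\<sigma> x \<in> Zmod v \<longleftrightarrow> x \<in> Zmod v" for x by (rule permutes_in_image[OF perm])
  have ex: "\<exists>q\<in>darts. [\<sigma> ((x + val p) mod int v) = \<sigma> x + val q] (mod int v)"
    if "x \<in> Zmod v" "p \<in> darts" for x p
  proof -
    have "(\<sigma> x, \<sigma> ((x + val p) mod int v)) \<in> parcs ?G"
      using arcs arc_val that by simp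
    then obtain q where "q \<in> darts" "[\<sigma> ((x + val p) mod int v) - \<sigma> x = val q] (mod int v)"
      using val_surj arc_iff by blast
    then show ?thesis by (intro bexI[of _ q]) (auto simp: cong_iff_dvd_diff algebra_simps)
  qed
  define M where "M x p = (SOME q. q \<in> darts \<and> [\<sigma> ((x + val p) mod int v) = \<sigma> x + val q] (mod int v))" for x p
  have M: "M x p \<in> darts" "[\<sigma> ((x + val p) mod int v) = \<sigma> x + val (M x p)] (mod int v)"
    if "x \<in> Zmod v" "p \<in> darts" for x p
    using someI_ex[of "\<lambda>q. q \<in> darts \<and> [\<sigma> ((x + val p) mod int v) = \<sigma> x + val q] (mod int v)"]
      ex[OF that] unfolding M_def by blast+
  have M_eq: "\<sigma> ((x + val p) mod int v) = (\<sigma> x + val (M x p)) mod int v"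
    if "x \<in> Zmod v" "p \<in> darts" for x p
    using M(2)[OF that] mod_Zmod[of "\<sigma> ((x + val p) mod int v)"] \<sigma>_in by (simp add: cong_def)
  have cancel: "q = q'" if "q \<in> darts" "q' \<in> darts" "(y + val q) mod int v = (y + val q') mod int v" for y q q'
    using val_inj[OF that(1,2)] that(3) by (metis cong_add_lcancel cong_def)
  have M_inj: "inj_on (M x) darts" if x: "x \<in> Zmod v" for x
  proof (rule inj_onI)
    fix p q assume pq: "p \<in> darts" "q \<in> darts" "M x p = M x q"
    then have "\<sigma> ((x + val p) mod int v) = \<sigma> ((x + val q) mod int v)"
      using M_eq[OF x] by simp
    then have "(x + val p) mod int v = (x + val q) mod int v"
      using permutes_inj[OF perm] by (simp add: inj_eq)
    then show "p = q" using cancel pq by blast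
  qed
  have map: "map_prod \<sigma> \<sigma> (\<rho> (x, (x + val p) mod int v)) = (\<sigma> x, (\<sigma> x + val (M x (rot p))) mod int v)"
    "map_prod \<sigma> \<sigma> (x, (x + val p) mod int v) = (\<sigma> x, (\<sigma> x + val (M x p)) mod int v)"
    if "x \<in> Zmod v" "p \<in> darts" for x p
    using that M_eq[of x] \<rho>_val by auto
  from comm show ?thesis
  proof
    assume c: "\<forall>e\<in>parcs ?G. map_prod \<sigma> \<sigma> (\<rho> e) = \<rho> (map_prod \<sigma> \<sigma> e)"
    have "M x (rot p) = rot (M x p)" if xp: "x \<in> Zmod v" "p \<in> darts" for x p
    proof -
      have "(\<sigma> x, (\<sigma> x + val (M x (rot p))) mod int v) = \<rho> (\<sigma> x, (\<sigma> x + val (M x p)) mod int v)"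
        using c arc_val[OF xp] map[OF xp] by metis
      also have "\<dots> = (\<sigma> x, (\<sigma> x + val (rot (M x p))) mod int v)"
        using \<rho>_val M(1)[OF xp] \<sigma>_in xp by simp
      finally show ?thesis using xp M(1) by (intro cancel[of _ _ "\<sigma> x"]) auto
    qed
    then have "dihedral True (M x)" if "x \<in> Zmod v" for x
      using that M(1) M_inj by (auto simp: dihedral_def)
    then show thesis using that M(2) by blast
  next
    assume c: "\<forall>e\<in>parcs ?G. map_prod \<sigma> \<sigma> (\<rho> e) = inv \<rho> (map_prod \<sigma> \<sigma> e)"
    have "rot (M x (rot p)) = M x p" if xp: "x \<in> Zmod v" "p \<in> darts" for x p
    proof -
      let ?z = "(\<sigma> x, (\<sigma> x + val (M x p)) mod int v)"
      obtain q where q: "q \<in> darts" "rot q = M x p" using rot_surj M(1)[OF xp] by blast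
      then have "\<rho> (\<sigma> x, (\<sigma> x + val q) mod int v) = ?z"
        using \<rho>_val \<sigma>_in xp by simp
      \<comment> \<open>\<open>inv \<rho>\<close> is a right inverse on the range of
        \<open>\<rho>\<close>, and \<open>q\<close> shows that \<open>?z\<close> lies in it.\<close>
      then have "\<rho> (inv \<rho> ?z) = ?z" by (metis f_inv_into_f rangeI)
      then have "?z = \<rho> (\<sigma> x, (\<sigma> x + val (M x (rot p))) mod int v)"
        using c arc_val[OF xp] map[OF xp] by metis
      also have "\<dots> = (\<sigma> x, (\<sigma> x + val (rot (M x (rot p)))) mod int v)"
        using \<rho>_val M(1) \<sigma>_in xp by simp
      finally show ?thesis using xp M(1) by (intro cancel[of _ _ "\<sigma> x"]) auto
    qed
    then have "dihedral False (M x)" if "x \<in> Zmod v" for x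
      using that M(1) M_inj by (auto simp: dihedral_def)
    then show thesis using that M(2) by blast
  qed
qed

text \<open>The dart \<open>neg p\<close> at \<open>x + val p\<close> leads back to
  \<open>x\<close>, so the images under \<open>\<sigma>\<close> of the edge and of its reverse must
  cancel as well.\<close>

lemma local_action_neg:
  assumes M: "\<And>x. x \<in> Zmod v \<Longrightarrow> dihedral \<epsilon> (M x)"
    and \<sigma>: "\<And>x p. x \<in> Zmod v \<Longrightarrow> p \<in> darts \<Longrightarrow> [\<sigma> ((x + val p) mod int v) = \<sigma> x + val (M x p)] (mod int v)"
    and x: "x \<in> Zmod v" and p: "p \<in> darts"
  shows "M ((x + val p) mod int v) (neg p) = neg (M x p)"
proof -
  let ?y = "(x + val p) mod int v"
  have "(?y + val (neg p)) mod int v = x" using mod_Zmod[OF x] by (simp add: mod_diff_left_eq)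
  then have "[\<sigma> x = \<sigma> ?y + val (M ?y (neg p))] (mod int v)" using \<sigma>[of ?y "neg p"] p by simp
  also have "[\<sigma> ?y + val (M ?y (neg p)) = \<sigma> x + val (M x p) + val (M ?y (neg p))] (mod int v)"
    using \<sigma>[OF x p] by (intro cong_add) auto
  finally have "int v dvd - (val (M x p) + val (M ?y (neg p)))"
    by (simp add: cong_iff_dvd_diff)
  then have "[val (M ?y (neg p)) = val (neg (M x p))] (mod int v)"
    by (simp add: cong_iff_dvd_diff add.commute dvd_minus_iff del: minus_add_distrib)
  then show ?thesis using dihedral_in[OF M] x p by (intro val_inj) auto
qed

text \<open>If \<open>M 0\<close> is the identity, \<open>M (val p mod int v)\<close> fixes
  \<open>neg p\<close> and hence every dart. So \<open>\<sigma>\<close> acts as adding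
  \<open>\<sigma> 0\<close> on the neighbours of 0, and one more step from such a neighbour reaches
  the multiples of \<open>w\<close>.\<close>

lemma translation_if_trivial:
  assumes perm: "\<sigma> permutes Zmod v"
    and M: "\<And>x. x \<in> Zmod v \<Longrightarrow> dihedral True (M x)"
    and \<sigma>: "\<And>x p. x \<in> Zmod v \<Longrightarrow> p \<in> darts \<Longrightarrow> [\<sigma> ((x + val p) mod int v) = \<sigma> x + val (M x p)] (mod int v)"
    and id: "\<And>q. q \<in> darts \<Longrightarrow> M 0 q = q" and ne: "B \<noteq> {}"
  shows "\<sigma> \<in> translation v ` Zmod v"
proof -
  have zero: "0 \<in> Zmod v" using v_pos by (simp add: Zmod_def)
  have idd: "dihedral True (\<lambda>p. p)" by (auto simp: dihedral_def)
  have M_id: "M (val p mod int v) q = q" if "p \<in> darts" "q \<in> darts" for p q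
  proof (rule dihedral_agree[OF M idd, of _ "neg p"])
    show "M (val p mod int v) (neg p) = neg p"
      using local_action_neg[of True M \<sigma> 0 p] M \<sigma> zero id that by simp
  qed (use that in auto)
  have near: "[\<sigma> (x mod int v) = \<sigma> 0 + x] (mod int v)" if x: "\<not> w dvd x" for x
  proof -
    obtain p where p: "p \<in> darts" "[x = val p] (mod int v)" using val_surj[OF x] .
    then have "[\<sigma> (x mod int v) = \<sigma> 0 + val p] (mod int v)"
      using \<sigma>[OF zero p(1)] id[OF p(1)] by (simp add: cong_def)
    also have "[\<sigma> 0 + val p = \<sigma> 0 + x] (mod int v)"
      using cong_sym[OF p(2)] by (intro cong_add) auto
    finally show ?thesis .
  qed
  have all: "[\<sigma> (x mod int v) = \<sigma> 0 + x] (mod int v)" for x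
  proof (cases "w dvd x")
    case True
    obtain p where p: "p \<in> darts" using ne by (auto simp: darts_def)
    have nd: "\<not> w dvd x - val p" "\<not> w dvd val p"
      using True val_not_dvd[OF p] by (auto simp: dvd_diff_right_iff)
    obtain q where q: "q \<in> darts" "[x - val p = val q] (mod int v)" using val_surj[OF nd(1)] .
    let ?y = "(x - val p) mod int v"
    have y: "?y = val q mod int v" using q(2) by (simp add: cong_def)
    have "(?y + val p) mod int v = x mod int v" by (simp add: mod_add_left_eq)
    then have "[\<sigma> (x mod int v) = \<sigma> ?y + val p] (mod int v)"
      using \<sigma>[of ?y p] M_id[OF q(1) p] p y by simp
    also have "[\<sigma> ?y + val p = \<sigma> 0 + (x - val p) + val p] (mod int v)"
      using near[OF nd(1)] by (intro cong_add) auto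
    finally show ?thesis by simp
  qed (rule near)
  have \<sigma>0: "\<sigma> 0 \<in> Zmod v" using permutes_in_image[OF perm] zero by blast
  have "\<sigma> x = translation v (\<sigma> 0) x" for x
  proof (cases "x \<in> Zmod v")
    case True
    then have "\<sigma> x \<in> Zmod v" using permutes_in_image[OF perm] by blast
    then show ?thesis using all[of x] True mod_Zmod[of x] mod_Zmod[of "\<sigma> x"]
      by (simp add: translation_def cong_def add.commute)
  next
    case False then show ?thesis using perm by (simp add: translation_def permutes_not_in)
  qed
  then show ?thesis using \<sigma>0 by blast
qed

text \<open>If the action is the same at all vertices, \<open>\<sigma> - \<sigma> 0\<close> is a group endomorphism,
  that is, multiplication by some \<open>u\<close>. Additivity is only available for non-multiples
  of \<open>w\<close>; at a multiple \<open>x\<close> of \<open>w\<close>, write \<open>x + 1 = (x - 1) + 2\<close>.\<close>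

lemma multiplier_if_uniform:
  assumes M: "\<And>x. x \<in> Zmod v \<Longrightarrow> dihedral \<epsilon> (M x)"
    and \<sigma>: "\<And>x p. x \<in> Zmod v \<Longrightarrow> p \<in> darts \<Longrightarrow> [\<sigma> ((x + val p) mod int v) = \<sigma> x + val (M x p)] (mod int v)"
    and uniform: "\<And>p q. p \<in> darts \<Longrightarrow> q \<in> darts \<Longrightarrow> M (val p mod int v) q = M 0 q"
  shows "\<exists>u\<in>{0..<int v}. \<forall>p\<in>darts. [val (M 0 p) = u * val p] (mod int v)"
proof -
  define s where "s x = \<sigma> (x mod int v) - \<sigma> 0" for x
  have zero: "0 \<in> Zmod v" using v_pos by (simp add: Zmod_def)
  have s_val: "[s x = val (M 0 p)] (mod int v)" if "p \<in> darts" "[x = val p] (mod int v)" for x p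
  proof -
    have "[\<sigma> (x mod int v) = \<sigma> 0 + val (M 0 p)] (mod int v)"
      using \<sigma>[OF zero that(1)] that(2) by (simp add: cong_def)
    then show ?thesis by (simp add: s_def cong_iff_dvd_diff algebra_simps)
  qed
  \<comment> \<open>Walk from 0 to \<open>x\<close> and on to \<open>x + y\<close>: by uniformity
    the second dart is again transformed by \<open>M 0\<close>.\<close>
  have s_add: "[s (x + y) = s x + s y] (mod int v)" if nd: "\<not> w dvd x" "\<not> w dvd y" for x y
  proof -
    obtain p where p: "p \<in> darts" "[x = val p] (mod int v)" using val_surj[OF nd(1)] .
    obtain q where q: "q \<in> darts" "[y = val q] (mod int v)" using val_surj[OF nd(2)] .
    have x: "x mod int v = val p mod int v" using p by (simp add: cong_def)
    have "(x + y) mod int v = (x mod int v + val q) mod int v"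
      using q(2) by (metis cong_def mod_add_cong mod_mod_trivial)
    then have "[\<sigma> ((x + y) mod int v) = \<sigma> (x mod int v) + val (M 0 q)] (mod int v)"
      using \<sigma>[of "x mod int v" q] uniform[OF p(1) q(1)] q(1) x by simp
    then have "[s (x + y) = s x + val (M 0 q)] (mod int v)"
      by (simp add: s_def cong_iff_dvd_diff algebra_simps)
    also have "[s x + val (M 0 q) = s x + s y] (mod int v)"
      using cong_sym[OF s_val[OF q]] by (intro cong_add) auto
    finally show ?thesis .
  qed
  have nd12: "\<not> w dvd 1" "\<not> w dvd 2" using parts by (auto dest: zdvd_imp_le)
  have s_Suc: "[s (x + 1) = s x + s 1] (mod int v)" for x
  proof (cases "w dvd x")
    case False then show ?thesis using s_add nd12 by blast
  next
    case True
    then have nd: "\<not> w dvd x - 1" using nd12(1) by (simp add: dvd_diff_right_iff)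
    have "[s (x - 1 + 2) = s (x - 1) + s 2] (mod int v)" using s_add nd nd12 by blast
    moreover have "[s (1 + 1) = s 1 + s 1] (mod int v)" using s_add nd12 by blast
    moreover have "[s (x - 1 + 1) = s (x - 1) + s 1] (mod int v)" using s_add nd nd12 by blast
    ultimately have "int v dvd s (x + 1) - (s (x - 1) + s 2)" "int v dvd s 2 - (s 1 + s 1)"
      "int v dvd s x - (s (x - 1) + s 1)"
      by (simp_all add: cong_iff_dvd_diff add.commute)
    then have "int v dvd (s (x + 1) - (s (x - 1) + s 2)) + (s 2 - (s 1 + s 1)) - (s x - (s (x - 1) + s 1))"
      by (rule dvd_diff[OF dvd_add])
    then show ?thesis by (simp add: cong_iff_dvd_diff algebra_simps)
  qed
  have lin: "[s (int k) = int k * s 1] (mod int v)" for k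
  proof (induction k)
    case 0 then show ?case by (simp add: s_def)
  next
    case (Suc k)
    have "[s (int k + 1) = s (int k) + s 1] (mod int v)" by (rule s_Suc)
    also have "[s (int k) + s 1 = int k * s 1 + s 1] (mod int v)"
      using Suc by (intro cong_add) auto
    finally show ?case by (simp add: algebra_simps)
  qed
  show ?thesis
  proof (intro bexI[of _ "s 1 mod int v"] ballI)
    fix p assume p: "p \<in> darts"
    let ?k = "nat (val p mod int v)"
    have k: "int ?k = val p mod int v" using v_pos by simp
    have "[val (M 0 p) = s (int ?k)] (mod int v)"
      using s_val[OF p, of "int ?k"] k by (simp add: cong_sym_eq cong_def)
    also have "[s (int ?k) = int ?k * s 1] (mod int v)" by (rule lin)
    also have "[int ?k * s 1 = (s 1 mod int v) * val p] (mod int v)"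
      unfolding k by (simp add: cong_def mod_mult_left_eq mod_mult_right_eq mult.commute)
    finally show "[val (M 0 p) = (s 1 mod int v) * val p] (mod int v)" .
  qed (use v_pos in auto)
qed

text \<open>The trace consists of \<open>M 0\<close> and the action at the vertices
  \<open>val p\<close>. The value \<open>\<sigma> 0\<close> is arbitrary: it cancels when the two
  paths to \<open>val p + val q\<close> are compared. If \<open>\<epsilon>\<close> holds,
  \<open>M 0\<close> is not the identity, since \<open>\<sigma>\<close> would then be a
  translation.\<close>

lemma aut_trace_exists:
  assumes aut: "\<sigma> \<in> embedding_Aut (Archdeacon_embedding v t A (entry_ordering A \<alpha>r) (entry_ordering A \<alpha>c))"
    and nontrivial: "\<sigma> \<notin> translation v ` Zmod v" and ne: "B \<noteq> {}"
  obtains \<epsilon> S M where "dihedral \<epsilon> S" "\<epsilon> \<Longrightarrow> \<exists>q\<in>darts. S q \<noteq> q" "aut_trace \<epsilon> S M A"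
proof -
  obtain \<epsilon> M where M: "\<And>x. x \<in> Zmod v \<Longrightarrow> dihedral \<epsilon> (M x)"
    and \<sigma>: "\<And>x p. x \<in> Zmod v \<Longrightarrow> p \<in> darts \<Longrightarrow> [\<sigma> ((x + val p) mod int v) = \<sigma> x + val (M x p)] (mod int v)"
    using local_action[OF aut] by blast
  have zero: "0 \<in> Zmod v" using v_pos by (simp add: Zmod_def)
  have perm: "\<sigma> permutes Zmod v"
    using aut by (auto simp: embedding_Aut_def Archdeacon_embedding_def graph_automorphism_def multipartite_graph_def)
  have 1: "\<exists>q\<in>darts. M 0 q \<noteq> q" if \<epsilon>
    using translation_if_trivial[of \<sigma> M] perm M \<sigma> ne nontrivial that by auto
  have 2: "[\<sigma> ((val p + val q) mod int v) = \<sigma> 0 + val (M 0 p) + val (M (val p mod int v) q)] (mod int v)"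
    if pq: "p \<in> darts" "q \<in> darts" for p q
  proof -
    have "(val p + val q) mod int v = (val p mod int v + val q) mod int v" by (simp add: mod_add_left_eq)
    then have "[\<sigma> ((val p + val q) mod int v) = \<sigma> (val p mod int v) + val (M (val p mod int v) q)] (mod int v)"
      using \<sigma>[of "val p mod int v" q] pq by simp
    also have "[\<sigma> (val p mod int v) + val (M (val p mod int v) q)
        = \<sigma> 0 + val (M 0 p) + val (M (val p mod int v) q)] (mod int v)"
      using \<sigma>[OF zero pq(1)] by (intro cong_add) auto
    finally show ?thesis .
  qed
  have "aut_trace \<epsilon> (M 0) (\<lambda>p. M (val p mod int v)) A"
    unfolding aut_trace_def
  proof (intro conjI ballI impI)
    fix p assume p: "p \<in> darts"
    show "dihedral \<epsilon> (M (val p mod int v))" by (rule M) simp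
    show "M (val p mod int v) (neg p) = neg (M 0 p)"
      using local_action_neg[of \<epsilon> M \<sigma> 0 p] M \<sigma> zero p by simp
    fix q assume q: "q \<in> darts"
    have "[\<sigma> 0 + val (M 0 p) + val (M (val p mod int v) q)
        = \<sigma> 0 + val (M 0 q) + val (M (val q mod int v) p)] (mod int v)"
      using cong_trans[OF cong_sym[OF 2[OF p q]] 2[OF q p, unfolded add.commute[of "val q" "val p"]]] .
    then show "[val (M 0 p) + val (M (val p mod int v) q)
        = val (M 0 q) + val (M (val q mod int v) p)] (mod int v)"
      by (simp add: cong_iff_dvd_diff algebra_simps)
  next
    assume "\<forall>p\<in>darts. \<forall>q\<in>darts. M (val p mod int v) q = M 0 q"
    then show "\<exists>u\<in>{0..<int v}. \<forall>p\<in>darts. [val (M 0 p) = u * val p] (mod int v)"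
      using multiplier_if_uniform[of \<epsilon> M \<sigma>] M \<sigma> by blast
  qed
  then show thesis using that M[OF zero] 1 by blast
qed

end

section \<open>Union bound over the dihedral maps\<close>

context Archdeacon_array
begin

text \<open>There are two flags, at most \<open>2 * card B\<close> maps \<open>S\<close> for each,
  and a proportion of at most \<open>4096 / card B ^ 2\<close> of the labellings for each map, which
  gives \<open>2 * 2 * 4096 = 16384\<close>.\<close>

lemma card_nontrivial_Aut:
  assumes N: "17 \<le> card B" and v3: "v \<le> 3 * card B"
  shows "real (card {A \<in> bij_maps B \<Omega>. \<exists>\<sigma>\<in>embedding_Aut (Archdeacon_embedding v t A
      (entry_ordering A \<alpha>r) (entry_ordering A \<alpha>c)). \<sigma> \<notin> translation v ` Zmod v})
    \<le> 16384 / real (card B) * fact (card B)" (is "real (card ?Bad) \<le> _")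
proof -
  let ?T = "\<lambda>\<epsilon> S. {A \<in> bij_maps B \<Omega>. \<exists>M. aut_trace \<epsilon> S M A}"
  let ?C = "\<lambda>\<epsilon>. {S \<in> darts \<rightarrow>\<^sub>E darts. dihedral \<epsilon> S \<and> (\<epsilon> \<longrightarrow> (\<exists>q\<in>darts. S q \<noteq> q))}"
  have ne: "B \<noteq> {}" using N by auto
  have finP: "finite (darts \<rightarrow>\<^sub>E darts)" using finite_darts by (intro finite_PiE)
  have fin: "finite (?C \<epsilon>)" for \<epsilon> by (rule finite_subset[OF _ finP]) auto
  have finT: "finite (?T \<epsilon> S)" for \<epsilon> S using finite_bij_maps[OF finite_B finite_\<Omega>] by simp
  have "?Bad \<subseteq> (\<Union>\<epsilon>\<in>UNIV. \<Union>S\<in>?C \<epsilon>. ?T \<epsilon> S)"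
  proof
    fix A assume bad: "A \<in> ?Bad"
    then interpret labelled_Archdeacon_array B \<alpha>r \<alpha>c \<Omega> v t A by unfold_locales simp
    obtain \<epsilon> S M where S: "dihedral \<epsilon> S" "\<epsilon> \<Longrightarrow> \<exists>q\<in>darts. S q \<noteq> q" and tr: "aut_trace \<epsilon> S M A"
      using bad aut_trace_exists[OF _ _ ne] by blast
    \<comment> \<open>A trace depends on \<open>S\<close> only through its values on
      \<open>darts\<close>; restricting makes it a member of the finite set
      \<open>?C \<epsilon>\<close>.\<close>
    let ?S = "restrict S darts"
    have "dihedral \<epsilon> ?S" using S(1) by (auto simp: dihedral_def inj_on_def)
    moreover have "?S \<in> darts \<rightarrow>\<^sub>E darts" using dihedral_in[OF S(1)] by auto
    moreover have "\<epsilon> \<longrightarrow> (\<exists>q\<in>darts. ?S q \<noteq> q)" using S(2) by auto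
    moreover have "aut_trace \<epsilon> ?S M A" using tr by (simp add: aut_trace_def)
    ultimately show "A \<in> (\<Union>\<epsilon>\<in>UNIV. \<Union>S\<in>?C \<epsilon>. ?T \<epsilon> S)" using bad by blast
  qed
  then have "card ?Bad \<le> card (\<Union>\<epsilon>\<in>UNIV. \<Union>S\<in>?C \<epsilon>. ?T \<epsilon> S)"
    using fin finT by (intro card_mono finite_UN_I) auto
  also have "\<dots> \<le> (\<Sum>\<epsilon>\<in>UNIV. card (\<Union>S\<in>?C \<epsilon>. ?T \<epsilon> S))" by (rule card_UN_le) simp
  also have "\<dots> \<le> (\<Sum>\<epsilon>\<in>UNIV. \<Sum>S\<in>?C \<epsilon>. card (?T \<epsilon> S))"
    using fin by (intro sum_mono card_UN_le)
  finally have "real (card ?Bad) \<le> real (\<Sum>\<epsilon>\<in>UNIV. \<Sum>S\<in>?C \<epsilon>. card (?T \<epsilon> S))"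
    by (rule of_nat_mono)
  also have "\<dots> = (\<Sum>\<epsilon>\<in>UNIV. \<Sum>S\<in>?C \<epsilon>. real (card (?T \<epsilon> S)))" by (simp only: of_nat_sum)
  also have "\<dots> \<le> (\<Sum>\<epsilon>\<in>(UNIV::bool set). real (2 * card B) * (4096 / real (card B) ^ 2 * fact (card B)))"
  proof (rule sum_mono)
    fix \<epsilon> :: bool
    have "(\<Sum>S\<in>?C \<epsilon>. real (card (?T \<epsilon> S))) \<le> real (card (?C \<epsilon>)) * (4096 / real (card B) ^ 2 * fact (card B))"
      using card_aut_trace[OF _ _ N v3] by (intro sum_bounded_above) auto
    also have "\<dots> \<le> real (2 * card B) * (4096 / real (card B) ^ 2 * fact (card B))"
    proof (rule mult_right_mono)
      have "card (?C \<epsilon>) \<le> card {S \<in> darts \<rightarrow>\<^sub>E darts. dihedral \<epsilon> S}"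
        by (rule card_mono) (auto intro: finite_subset[OF _ finP])
      also have "\<dots> \<le> 2 * card B" using card_dihedral[OF ne] card_darts by simp
      finally show "real (card (?C \<epsilon>)) \<le> real (2 * card B)" by (rule of_nat_mono)
    qed simp
    finally show "(\<Sum>S\<in>?C \<epsilon>. real (card (?T \<epsilon> S)))
      \<le> real (2 * card B) * (4096 / real (card B) ^ 2 * fact (card B))" .
  qed
  also have "\<dots> = 16384 / real (card B) * fact (card B)"
    using N by (simp add: UNIV_bool power2_eq_square field_simps)
  finally show ?thesis .
qed

end

section \<open>The probability bound\<close>

lemma card_cell_set:
  assumes "cell_set m n h k B"
  shows "finite B" "card B = n * k"
proof -
  show fin: "finite B" using assms by (auto simp: cell_set_def intro: finite_subset)
  have "B = (\<Union>j<n. col_of B j)" using assms by (auto simp: cell_set_def col_of_def)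
  also have "card \<dots> = (\<Sum>j<n. card (col_of B j))"
    using fin by (intro card_UN_disjoint) (auto simp: col_of_def)
  also have "\<dots> = n * k" using assms by (simp add: cell_set_def)
  finally show "card B = n * k" .
qed

text \<open>Equal cardinalities make the entries pairwise distinct, so their multiset is
  \<open>mset_set \<Omega>\<close> for every bijection and the Heffter condition becomes the one on
  \<open>\<Omega>\<close>. The random array is thus a uniformly random bijection.\<close>

lemma QH_class_eq:
  assumes "t > 0" "t dvd 2 * n * k" "cell_set m n h k B" "\<Omega> \<subseteq> Zmod (2 * n * k + t)"
    and "plus_minus (2 * n * k + t) (mset_set \<Omega>)
      = mset_set (Zmod (2 * n * k + t) - Jsub (2 * n * k + t) t)"
    and "card \<Omega> = card B"
  shows "QH_class t m n h k B \<Omega> = bij_maps B \<Omega>"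
proof -
  have "entries_mset A = mset_set \<Omega>" if "A \<in> bij_maps B \<Omega>" for A
    using bij_maps_inj_on[OF card_cell_set(1)[OF assms(3)] assms(6)[symmetric] that] that
    by (simp add: entries_mset_def bij_maps_def image_mset_mset_set)
  then show ?thesis using assms
    by (auto simp: QH_class_def bij_maps_def quasi_Heffter_def Let_def)
qed

lemma card_Jsub:
  assumes "t dvd v" "0 < v"
  shows "card (Jsub v t) = t"
proof -
  define w where "w = int (v div t)"
  have v: "int v = w * int t" unfolding w_def using assms(1) by (simp flip: of_nat_mult)
  have w0: "0 < w" unfolding w_def using assms by (auto simp: dvd_def)
  have J: "x \<in> Jsub v t \<longleftrightarrow> 0 \<le> x \<and> x < w * int t \<and> w dvd x" for x
    unfolding Jsub_iff[OF assms] Zmod_def w_def[symmetric] v[symmetric] by simp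
  have "Jsub v t = (\<lambda>y. w * y) ` {0..<int t}"
  proof (intro set_eqI iffI)
    fix x assume "x \<in> Jsub v t"
    then obtain y where y: "0 \<le> w * y" "w * y < w * int t" "x = w * y" by (auto simp: J dvd_def)
    then have "0 \<le> y" "y < int t" using w0 by (auto simp: zero_le_mult_iff)
    then show "x \<in> (\<lambda>y. w * y) ` {0..<int t}" using y by auto
  qed (use w0 in \<open>auto simp: J\<close>)
  then show ?thesis using w0 by (simp add: card_image inj_on_def)
qed

text \<open>The right-hand side of \<open>pm\<close> has multiplicities at most 1, whereas
  \<open>x = - y\<close> inside \<open>\<Omega>\<close> would count \<open>x\<close> once as a label
  and once as a negative. This covers \<open>x = y\<close> too.\<close>

lemma half_set_properties:
  assumes "t dvd v" "0 < v" "\<Omega> \<subseteq> Zmod v"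
    and pm: "plus_minus v (mset_set \<Omega>) = mset_set (Zmod v - Jsub v t)"
  shows "2 * card \<Omega> = v - t"
    and "x \<in> Zmod v \<Longrightarrow> x \<notin> Jsub v t \<longleftrightarrow> (\<exists>y\<in>\<Omega>. x = y \<or> x = (- y) mod int v)"
    and "x \<in> \<Omega> \<Longrightarrow> y \<in> \<Omega> \<Longrightarrow> \<not> [x = - y] (mod int v)"
proof -
  let ?D = "Zmod v - Jsub v t"
  have finZ: "finite (Zmod v)" by (simp add: Zmod_def)
  have fin\<Omega>: "finite \<Omega>" using finZ assms(3) finite_subset by blast
  have J: "Jsub v t \<subseteq> Zmod v" using Jsub_iff[OF assms(1,2)] by auto
  have "card ?D = v - t"
    using card_Jsub[OF assms(1,2)] J finZ by (simp add: card_Diff_subset finite_subset Zmod_def)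
  then show "2 * card \<Omega> = v - t"
    using arg_cong[OF pm, of size] by (simp add: plus_minus_def)
  have "set_mset (plus_minus v (mset_set \<Omega>)) = ?D" using pm finZ by simp
  then have D: "?D = \<Omega> \<union> (\<lambda>x. (- x) mod int v) ` \<Omega>" using fin\<Omega> by (simp add: plus_minus_def)
  then show "x \<in> Zmod v \<Longrightarrow> x \<notin> Jsub v t \<longleftrightarrow> (\<exists>y\<in>\<Omega>. x = y \<or> x = (- y) mod int v)" by blast
  assume xy: "x \<in> \<Omega>" "y \<in> \<Omega>"
  show "\<not> [x = - y] (mod int v)"
  proof
    assume "[x = - y] (mod int v)"
    then have "x = (- y) mod int v" using xy(1) assms(3) by (auto simp: cong_def Zmod_def)
    then have "0 < count (image_mset (\<lambda>x. (- x) mod int v) (mset_set \<Omega>)) x"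
      using xy fin\<Omega> by (auto simp: count_greater_zero_iff)
    moreover have "0 < count (mset_set \<Omega>) x" using xy fin\<Omega> by simp
    ultimately have "2 \<le> count (mset_set ?D) x"
      unfolding pm[symmetric] plus_minus_def count_union by linarith
    moreover have "count (mset_set ?D) x \<le> 1" by (simp add: count_mset_set')
    ultimately show False by linarith
  qed
qed

theorem theorem3p12:
  fixes t :: nat
  assumes "t > 0"
  shows "\<exists>C :: real. \<forall>(m :: nat) (n :: nat) (h :: nat) (k :: nat) (B :: cell set)
           (\<alpha>r :: cell \<Rightarrow> cell) (\<alpha>c :: cell \<Rightarrow> cell) (\<Omega> :: int set).
         m > 0 \<longrightarrow> n > 0 \<longrightarrow> h \<ge> 3 \<longrightarrow> k \<ge> 3 \<longrightarrow> t dvd 2 * n * k \<longrightarrow>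
         cell_set m n h k B \<longrightarrow>
         compatible_orderings B \<alpha>r \<alpha>c \<longrightarrow>
         \<Omega> \<subseteq> Zmod (2 * n * k + t) \<longrightarrow>
         plus_minus (2 * n * k + t) (mset_set \<Omega>)
           = mset_set (Zmod (2 * n * k + t) - Jsub (2 * n * k + t) t) \<longrightarrow>
         measure_pmf.prob (pmf_of_set (QH_class t m n h k B \<Omega>))
           {A. \<exists>\<sigma> \<in> embedding_Aut (Archdeacon_embedding (2 * n * k + t) t A
                                     (entry_ordering A \<alpha>r) (entry_ordering A \<alpha>c)).
                 \<sigma> \<notin> translation (2 * n * k + t) ` Zmod (2 * n * k + t)}
           \<le> C / real (n * k)"
proof (intro exI[of _ "16401 + real t"] allI impI)
  fix m n h k :: nat and B :: "cell set" and \<alpha>r \<alpha>c :: "cell \<Rightarrow> cell" and \<Omega> :: "int set"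
  let ?v = "2 * n * k + t"
  let ?Bad = "{A. \<exists>\<sigma> \<in> embedding_Aut (Archdeacon_embedding ?v t A (entry_ordering A \<alpha>r) (entry_ordering A \<alpha>c)).
    \<sigma> \<notin> translation ?v ` Zmod ?v}"
  assume "m > 0" "n > 0" and h: "h \<ge> 3" and k: "k \<ge> 3" and t_dvd: "t dvd 2 * n * k"
    and cells: "cell_set m n h k B"
    and compat: "compatible_orderings B \<alpha>r \<alpha>c"
    and \<Omega>: "\<Omega> \<subseteq> Zmod ?v"
    and pm: "plus_minus ?v (mset_set \<Omega>) = mset_set (Zmod ?v - Jsub ?v t)"
  note B = card_cell_set[OF cells]
  have tv: "t dvd ?v" "0 < ?v" using t_dvd assms by auto
  note half = half_set_properties[OF tv \<Omega> pm]
  have card: "card \<Omega> = card B" using half(1) B(2) by simp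
  have Q: "QH_class t m n h k B \<Omega> = bij_maps B \<Omega>"
    by (rule QH_class_eq[OF assms t_dvd cells \<Omega> pm card])
  have fin\<Omega>: "finite \<Omega>" using \<Omega> by (auto simp: Zmod_def intro: finite_subset)
  have nk: "0 < n * k" using \<open>n > 0\<close> k by simp
  have cardQ: "card (bij_maps B \<Omega>) = fact (card B)" using card_bij_maps[OF B(1) fin\<Omega>] card by simp
  then have neQ: "bij_maps B \<Omega> \<noteq> {}" by (metis card.empty fact_nonzero)
  have finQ: "finite (bij_maps B \<Omega>)" by (rule finite_bij_maps[OF B(1) fin\<Omega>])
  let ?p = "measure_pmf.prob (pmf_of_set (bij_maps B \<Omega>)) ?Bad"
  \<comment> \<open>The constant is \<open>16384 + 17 + t\<close>. For \<open>n * k < 17 + t\<close>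
    it makes the bound at least 1. Otherwise \<open>17 \<le> n * k\<close> permits the choice of
    darts, and \<open>t \<le> n * k\<close> gives both \<open>3 \<le> ?v div t\<close> and
    \<open>?v \<le> 3 * (n * k)\<close>.\<close>
  have "?p \<le> (16401 + real t) / real (n * k)"
  proof (cases "n * k < 17 + t")
    case True
    have "?p \<le> 1" by simp
    also have "1 \<le> (16401 + real t) / real (n * k)"
      using True nk by (simp add: le_divide_eq flip: of_nat_mult)
    finally show ?thesis .
  next
    case False
    have parts: "2 < ?v div t"
    proof -
      have "t * 3 \<le> ?v" using False by simp
      then have "3 \<le> ?v div t" using assms by (simp add: less_eq_div_iff_mult_less_eq mult.commute)
      then show ?thesis by simp
    qed
    interpret Archdeacon_array B \<alpha>r \<alpha>c \<Omega> ?v t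
    proof
      show "3 \<le> card (row_of B (fst c))" "3 \<le> card (col_of B (snd c))" if "c \<in> B" for c
        using that cells h k by (auto simp: cell_set_def)
    qed (use B compat fin\<Omega> card \<Omega> half tv parts in \<open>auto simp: Zmod_def\<close>)
    have "?p = real (card {A \<in> bij_maps B \<Omega>. A \<in> ?Bad}) / fact (card B)"
      using measure_pmf_of_set[OF neQ finQ, of ?Bad] cardQ by (simp add: Int_def)
    also have "\<dots> \<le> (16384 / real (card B) * fact (card B)) / fact (card B)"
      using card_nontrivial_Aut B(2) False by (intro divide_right_mono) (auto simp: algebra_simps)
    also have "\<dots> = 16384 / real (n * k)" using B(2) by simp
    also have "\<dots> \<le> (16401 + real t) / real (n * k)" by (intro divide_right_mono) auto
    finally show ?thesis .
  qed
  then show "measure_pmf.prob (pmf_of_set (QH_class t m n h k B \<Omega>)) ?Bad \<le> (16401 + real t) / real (n * k)"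
    by (simp only: Q)
qed

end
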